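(* Let $c>0$ and let $Q_N(\zeta)=\tfrac12\xi^2+\tfrac12\tfrac{N}{c^2}\eta^2$ for $\zeta=\xi+i\eta\in\mathbb{C}$. Let $\{\zeta_j\}_1^N$ be a random sample from the Gibbs measure $\mathbf{P}_N$ associated with $Q_N$ (at $\beta=1$), let $\mathbf{R}_N$ be its $1$-point function, and let $c_N(\xi)=\tfrac1N\int_{\mathbb{R}}\mathbf{R}_N(\xi+i\eta)\,d\eta$. Then, for each $\xi$ with $-2<\xi<2$, $$\lim_{N\to\infty}c_N(\xi)=\pi\cdot\sigma_{\mathrm{sc}}(\xi),\qquad \sigma_{\mathrm{sc}}(\xi)=\tfrac1{2\pi}\sqrt{4-\xi^2}\cdot\mathbf{1}_{[-2,2]}(\xi).$$
   Context: $dA(\zeta)=\tfrac1\pi\,d\xi\,d\eta$ is normalized Lebesgue measure on $\mathbb{C}$ and $dA_N=(dA)^{\otimes N}$. For a potential $Q_N$ put $H_N=\sum_{j\ne k}\log\frac1{|\zeta_j-\zeta_k|}+N\sum_{j=1}^NQ_N(\zeta_j)$. The Gibbs measure at $\beta=1$ is $d\mathbf{P}_N=\frac1{Z_N}e^{-H_N}\,dA_N$ on $\mathbb{C}^N$, with $Z_N$ the normalizing constant. The $1$-point function is $\mathbf{R}_N(\zeta)=\lim_{\varepsilon\to0}\varepsilon^{-2}\,\mathbf{E}_N[\#(\{\zeta_j\}_1^N\cap D(\zeta,\varepsilon))]$, where $D(\zeta,\varepsilon)$ is the open disc with center $\zeta$ and radius $\varepsilon$ (i.e. the density of the expected number of particles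 with respect to $dA$). *)

theory Defs
  imports "HOL-Probability.Probability"
begin

definition dA :: "complex measure" where
  "dA = density lborel (\<lambda>_. ennreal (1 / pi))"

text \<open>Points of \<open>\<complex>\<^sup>N\<close> are functions on the index set \<open>{..<N}\<close>, as in the library's
  finite product measures.\<close>

definition dA_prod :: "nat \<Rightarrow> (nat \<Rightarrow> complex) measure" where
  "dA_prod N = PiM {..<N} (\<lambda>_. dA)"

text \<open>On the diagonals \<open>\<zeta> j = \<zeta> k\<close> the energy is \<open>+\<infinity>\<close>, while here \<open>ln (1 / 0) = 0\<close>.
  The diagonals are null sets of \<open>dA_prod N\<close>, so the Gibbs measure is unaffected.\<close>

definition energy :: "(complex \<Rightarrow> real) \<Rightarrow> nat \<Rightarrow> (nat \<Rightarrow> complex) \<Rightarrow> real" where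
  "energy Q N \<zeta> =
     (\<Sum>j<N. \<Sum>k\<in>{..<N} - {j}. ln (1 / cmod (\<zeta> j - \<zeta> k))) + real N * (\<Sum>j<N. Q (\<zeta> j))"

definition partition_function :: "(complex \<Rightarrow> real) \<Rightarrow> nat \<Rightarrow> real" where
  "partition_function Q N = (LINT \<zeta>|dA_prod N. exp (- energy Q N \<zeta>))"

definition gibbs_measure :: "(complex \<Rightarrow> real) \<Rightarrow> nat \<Rightarrow> (nat \<Rightarrow> complex) measure" where
  "gibbs_measure Q N =
     density (dA_prod N) (\<lambda>\<zeta>. ennreal (exp (- energy Q N \<zeta>) / partition_function Q N))"

definition one_point_function :: "(complex \<Rightarrow> real) \<Rightarrow> nat \<Rightarrow> complex \<Rightarrow> real" where
  "one_point_function Q N z =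
     Lim (at_right 0) (\<lambda>\<epsilon>::real.
       (LINT \<zeta>|gibbs_measure Q N. real (card {j. j < N \<and> \<zeta> j \<in> ball z \<epsilon>})) / \<epsilon>\<^sup>2)"

definition cross_section :: "(complex \<Rightarrow> real) \<Rightarrow> nat \<Rightarrow> real \<Rightarrow> real" where
  "cross_section Q N \<xi> = (1 / real N) * (LINT \<eta>|lborel. one_point_function Q N (Complex \<xi> \<eta>))"

definition ellipse_potential :: "real \<Rightarrow> nat \<Rightarrow> complex \<Rightarrow> real" where
  "ellipse_potential c N z = (1/2) * (Re z)\<^sup>2 + (1/2) * (real N / c\<^sup>2) * (Im z)\<^sup>2"

definition semicircle_density :: "real \<Rightarrow> real" where
  "semicircle_density \<xi> = (1 / (2 * pi)) * sqrt (4 - \<xi>\<^sup>2) * indicator {-2..2} \<xi>"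

end

theory Submission
  imports Defs "Jordan_Normal_Form.Determinant"
begin

text \<open>
  At \<open>\<beta> = 1\<close> the Gibbs density is \<open>\<Prod>\<^sub>j\<^sub>\<noteq>\<^sub>k |\<zeta>\<^sub>j - \<zeta>\<^sub>k| \<cdot> \<Prod>\<^sub>j exp (- N Q (\<zeta>\<^sub>j))\<close>, that is, the squared
  modulus of a Vandermonde determinant times a product weight. Expanding the determinant in monic
  polynomials that are orthogonal for the weight gives the one-point function
  \<open>R(z) = \<Sum>\<^sub>m\<^sub><\<^sub>N |p\<^sub>m(z)|\<^sup>2 exp (- N Q(z)) / h\<^sub>m\<close> (lemmas \<open>det_monic_polynomials\<close> and
  \<open>expected_number_of_particles\<close>).

  For the ellipse potential the weight is a Gaussian with variances \<open>v = 1/N\<close> along the real axis and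
  \<open>w = c\<^sup>2/N\<^sup>2\<close> along the imaginary axis. Write \<open>H\<^sup>v\<^sub>n\<close> for the monic Hermite polynomial of variance \<open>v\<close>.
  The Appell identity \<open>H\<^bsup>v-w\<^esup>\<^sub>n(x + iy) = \<Sum>\<^sub>k (n choose k) i\<^bsup>n-k\<^esup> H\<^sup>v\<^sub>k(x) H\<^sup>w\<^sub>n\<^sub>-\<^sub>k(y)\<close> separates the two variables, so
  one-dimensional Hermite orthogonality does all the integration: it shows that \<open>p\<^sub>n = H\<^bsup>v-w\<^esup>\<^sub>n\<close>, with
  \<open>h\<^sub>n\<close> proportional to \<open>n! (v + w)\<^sup>n\<close>, and it evaluates the integral of \<open>|p\<^sub>n|\<^sup>2\<close> over a vertical line as
  a sum of squares of the \<open>H\<^sup>v\<^sub>k\<close>. After normalization the coefficients of this sum are binomial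
  probabilities with success parameter \<open>p = v/(v + w) = N/(N + c\<^sup>2)\<close>. Thus the cross-section is an explicit factor times
  \<open>\<Sum>\<^sub>n\<^sub><\<^sub>N E[u (Bin(n, p))]\<close>, where \<open>u k\<close> is the \<open>k\<close>-th squared Hermite function of the Gaussian unitary
  ensemble at \<open>\<xi>\<close>. The sum telescopes to \<open>E[K (Bin(N, p))] / p\<close> with \<open>K m = \<Sum>\<^sub>k\<^sub><\<^sub>m u k\<close>. On average
  the thinning removes only \<open>N (1 - p) < c\<^sup>2\<close> of the \<open>N\<close> levels, and in the bulk one level
  carries a share \<open>O(1/N)\<close> of \<open>K N\<close>; so the limit is that of \<open>K N\<close>
  (theorem \<open>thinned_hermite_kernel_semicircle\<close>).

  There remains the pointwise semicircle law for \<open>K N\<close> (theorem \<open>hermite_kernel_semicircle\<close>). By the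
  Christoffel-Darboux formula \<open>K N\<close> is, up to normalization and a relative error \<open>O(1/N)\<close>, the energy \<open>G = f'\<^sup>2 + q f\<^sup>2\<close> of the
  oscillator \<open>f'' = - q f\<close> satisfied by the \<open>N\<close>-th Hermite function, with \<open>q(x)\<close> close to
  \<open>N\<^sup>2 (1 - x\<^sup>2/4)\<close>. For a slowly varying frequency \<open>G / sqrt q\<close> is an adiabatic invariant: it is
  constant up to a factor \<open>1 + O(1/N)\<close> on compact subsets of \<open>(-2, 2)\<close>. Hence \<open>G(x)\<close> is proportional to
  \<open>sqrt (1 - x\<^sup>2/4)\<close>, and Wallis's product supplies the value at \<open>x = 0\<close>.
\<close>

section \<open>Hermite polynomials of a given variance\<close>

text \<open>
  Monic Hermite polynomials for the centred Gaussian of variance \<open>v\<close>: the three-term recurrence makes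
  sense over any commutative ring and for negative \<open>v\<close>, and both are needed. The planar orthogonal
  polynomials have complex argument and parameter, and the imaginary direction enters with variance \<open>- w\<close>.
\<close>
fun hermite :: "'a::comm_ring_1 \<Rightarrow> nat \<Rightarrow> 'a \<Rightarrow> 'a" where
  "hermite v 0 x = 1"
| "hermite v (Suc 0) x = x"
| "hermite v (Suc (Suc n)) x = x * hermite v (Suc n) x - v * of_nat (Suc n) * hermite v n x"

lemma hermite_rec:
  "x * hermite v n x = hermite v (Suc n) x + v * of_nat n * hermite v (n - 1) x"
  by (cases n) (simp_all add: algebra_simps)

text \<open>
  The absorption identity \<open>k (n choose k) = n (n-1 choose k-1)\<close> in the form in which the lowering terms
  of the Hermite recurrence produce it.
\<close>
lemma binomial_weight_sum:
  fixes f :: "nat \<Rightarrow> 'a::comm_ring_1"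
  shows "(\<Sum>k\<le>n. of_nat (n choose k) * (of_nat k * f k)) =
         of_nat n * (\<Sum>k\<le>n - 1. of_nat ((n - 1) choose k) * f (Suc k))"
proof (cases n)
  case 0
  then show ?thesis by simp
next
  case (Suc m)
  have "of_nat (Suc m choose Suc k) * (of_nat (Suc k) * f (Suc k)) =
        of_nat (Suc m) * (of_nat (m choose k) * f (Suc k))" for k
  proof -
    have "(of_nat (Suc k * (Suc m choose Suc k)) :: 'a) = of_nat (Suc m * (m choose k))"
      by (metis Suc_times_binomial_eq mult.commute)
    then show ?thesis
      by (metis (mono_tags, lifting) mult.assoc mult.commute of_nat_mult)
  qed
  then show ?thesis
    using Suc by (simp only: sum.atMost_Suc_shift diff_Suc_1 sum_distrib_left) simp
qed

lemma sum_binomial_reflect: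
  fixes f :: "nat \<Rightarrow> nat \<Rightarrow> 'a::comm_ring_1"
  shows "(\<Sum>k\<le>n. of_nat (n choose k) * f k (n - k)) = (\<Sum>k\<le>n. of_nat (n choose k) * f (n - k) k)"
  by (rule sum.reindex_bij_witness[of _ "\<lambda>k. n - k" "\<lambda>k. n - k"])
    (auto simp: binomial_symmetric[symmetric])

lemma sum_binomial_Suc:
  fixes f :: "nat \<Rightarrow> nat \<Rightarrow> 'a::comm_ring_1"
  shows "(\<Sum>k\<le>Suc n. of_nat (Suc n choose k) * f k (Suc n - k)) =
         (\<Sum>k\<le>n. of_nat (n choose k) * (f (Suc k) (n - k) + f k (Suc (n - k))))"
proof -
  have "(\<Sum>k\<le>n. of_nat (n choose k) * (f (Suc k) (n - k) + f k (Suc (n - k))))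
    = (\<Sum>k\<le>n. of_nat (n choose k) * f (Suc k) (n - k)) + (\<Sum>k\<le>n. of_nat (n choose k) * f k (Suc n - k))"
    by (simp add: sum.distrib algebra_simps Suc_diff_le)
  also have "(\<Sum>k\<le>n. of_nat (n choose k) * f k (Suc n - k)) =
      (\<Sum>k\<le>Suc n. of_nat (n choose k) * f k (Suc n - k))" by (simp add: binomial_eq_0)
  also have "\<dots> = f 0 (Suc n) + (\<Sum>k\<le>n. of_nat (n choose Suc k) * f (Suc k) (n - k))"
    by (subst sum.atMost_Suc_shift) simp
  finally have e: "(\<Sum>k\<le>n. of_nat (n choose k) * (f (Suc k) (n - k) + f k (Suc (n - k)))) = f 0 (Suc n) +
     (\<Sum>k\<le>n. of_nat (Suc n choose Suc k) * f (Suc k) (n - k))"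
    by (simp add: sum.distrib algebra_simps)
  show ?thesis unfolding e by (subst sum.atMost_Suc_shift) simp
qed

text \<open>
  The generating function of \<open>H\<^sub>n(x)/n!\<close> is \<open>exp (x t - v t\<^sup>2/2)\<close>, which is multiplicative in \<open>(x, v)\<close>.
  The proof below avoids power series: both sides satisfy the same three-term recurrence, because
  multiplication by \<open>x + y\<close> acts on the right-hand side as the sum of the two recurrences.
\<close>
lemma hermite_add:
  fixes x y :: "'a::comm_ring_1"
  shows "hermite (v + w) n (x + y) =
    (\<Sum>k\<le>n. of_nat (n choose k) * (hermite v k x * hermite w (n - k) y))"
proof (induction n rule: less_induct)
  case (less n)
  define S where "S m = (\<Sum>k\<le>m. of_nat (m choose k) * (hermite v k x * hermite w (m - k) y))" for m
  have rec: "(x + y) * S m = S (Suc m) + (v + w) * of_nat m * S (m - 1)" for m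
  proof -
    have "(x + y) * S m = (\<Sum>k\<le>m. of_nat (m choose k) *
        ((x * hermite v k x) * hermite w (m - k) y + hermite v k x * (y * hermite w (m - k) y)))"
      unfolding S_def sum_distrib_left by (intro sum.cong refl) (simp add: algebra_simps)
    also have "\<dots> = (\<Sum>k\<le>m. of_nat (m choose k) *
        (hermite v (Suc k) x * hermite w (m - k) y + hermite v k x * hermite w (Suc (m - k)) y))
      + v * (\<Sum>k\<le>m. of_nat (m choose k) * (of_nat k * (hermite v (k - 1) x * hermite w (m - k) y)))
      + w * (\<Sum>k\<le>m. of_nat (m choose k) * (of_nat (m - k) * (hermite v k x * hermite w (m - k - 1) y)))"
      unfolding hermite_rec sum_distrib_left sum.distrib[symmetric]
      by (intro sum.cong refl) (simp add: algebra_simps)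
    also have "(\<Sum>k\<le>m. of_nat (m choose k) * (of_nat (m - k) * (hermite v k x * hermite w (m - k - 1) y)))
       = (\<Sum>k\<le>m. of_nat (m choose k) * (of_nat k * (hermite v (m - k) x * hermite w (k - 1) y)))"
      by (rule sum_binomial_reflect[where f = "\<lambda>i j. of_nat j * (hermite v i x * hermite w (j - 1) y)"])
    also have "\<dots> = of_nat m * (\<Sum>k\<le>m - 1. of_nat ((m - 1) choose k) * (hermite v (m - 1 - k) x * hermite w k y))"
      by (subst binomial_weight_sum[where f = "\<lambda>k. hermite v (m - k) x * hermite w (k - 1) y"]) simp
    also have "(\<Sum>k\<le>m - 1. of_nat ((m - 1) choose k) * (hermite v (m - 1 - k) x * hermite w k y)) = S (m - 1)"
      unfolding S_def
      by (rule sum_binomial_reflect[symmetric, where f = "\<lambda>i j. hermite v i x * hermite w j y"])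
    also have "(\<Sum>k\<le>m. of_nat (m choose k) * (of_nat k * (hermite v (k - 1) x * hermite w (m - k) y))) = of_nat m * S (m - 1)"
      unfolding S_def
      by (subst binomial_weight_sum[where f = "\<lambda>k. hermite v (k - 1) x * hermite w (m - k) y"]) simp
    also have "(\<Sum>k\<le>m. of_nat (m choose k) *
        (hermite v (Suc k) x * hermite w (m - k) y + hermite v k x * hermite w (Suc (m - k)) y)) = S (Suc m)"
      unfolding S_def
      by (rule sum_binomial_Suc[symmetric, where f = "\<lambda>i j. hermite v i x * hermite w j y"])
    finally show ?thesis by (simp add: algebra_simps)
  qed
  consider "n = 0" | "n = 1" | m where "n = Suc (Suc m)"
    by (metis One_nat_def not0_implies_Suc)
  then show ?case
  proof cases
    case 3
    have IH: "hermite (v + w) m (x + y) = S m" "hermite (v + w) (Suc m) (x + y) = S (Suc m)"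
      unfolding S_def using less.IH 3 by auto
    have "S (Suc (Suc m)) = (x + y) * S (Suc m) - (v + w) * of_nat (Suc m) * S m"
      using rec[of "Suc m"] by (simp add: algebra_simps)
    then show ?thesis using 3 by (simp add: IH S_def)
  qed auto
qed

lemma hermite_of_real: "hermite (of_real v) n (of_real x) = (of_real (hermite v n x) :: complex)"
  by (induction v n x rule: hermite.induct) simp_all

lemma hermite_imaginary_axis:
  "hermite (- of_real v) n (\<i> * of_real y) = \<i> ^ n * (of_real (hermite v n y) :: complex)"
proof (induction v n y rule: hermite.induct)
  case (3 v n x)
  have "hermite (- of_real v) (Suc (Suc n)) (\<i> * of_real x) =
     \<i> * of_real x * (\<i> ^ Suc n * of_real (hermite v (Suc n) x)) + of_real v * of_nat (Suc n) * (\<i> ^ n * (of_real (hermite v n x) :: complex))"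
    using 3 by simp
  also have "\<dots> = \<i> ^ Suc (Suc n) * of_real (hermite v (Suc (Suc n)) x)"
    by (simp add: algebra_simps)
  finally show ?case .
qed simp_all

text \<open>
  The key separation of variables. Rotating the argument of a Hermite polynomial to the imaginary axis
  flips the sign of its variance, so a planar Hermite polynomial of variance \<open>v - w\<close> splits into
  polynomials of variance \<open>v\<close> in the real part and of variance \<open>w\<close> in the imaginary part.
\<close>
lemma hermite_complex_expansion:
  "hermite (of_real (v - w)) n (Complex x y) =
    (\<Sum>k\<le>n. of_nat (n choose k) * \<i> ^ (n - k) * of_real (hermite v k x * hermite w (n - k) y))"
proof -
  have "hermite (of_real (v - w)) n (Complex x y) =
      hermite (of_real v + (- of_real w)) n (of_real x + \<i> * of_real y)"
    by (simp add: Complex_eq)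
  also have "\<dots> = (\<Sum>k\<le>n. of_nat (n choose k) * \<i> ^ (n - k) * of_real (hermite v k x * hermite w (n - k) y))"
    by (subst hermite_add) (simp add: hermite_of_real hermite_imaginary_axis algebra_simps)
  finally show ?thesis .
qed

lemma hermite_deriv:
  "(hermite v n has_field_derivative of_nat n * hermite v (n - 1) x) (at x)"
  for v :: "'a::real_normed_field"
proof (induction n rule: less_induct)
  case (less n)
  consider "n = 0" | "n = 1" | m where "n = Suc (Suc m)"
    by (metis One_nat_def not0_implies_Suc)
  then show ?case
  proof cases
    case 1
    moreover have "hermite v 0 = (\<lambda>x. 1)" by auto
    ultimately show ?thesis by simp
  next
    case 2
    moreover have "hermite v 1 = (\<lambda>x. x)" by auto
    ultimately show ?thesis by simp
  next
    case 3
    have "((\<lambda>x. x * hermite v (Suc m) x - v * of_nat (Suc m) * hermite v m x) has_field_derivative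
       (1 * hermite v (Suc m) x + (of_nat (Suc m) * hermite v m x) * x)
         - v * of_nat (Suc m) * (of_nat m * hermite v (m - 1) x)) (at x)"
      using less.IH[of m] less.IH[of "Suc m"] 3
      by (intro DERIV_diff DERIV_mult DERIV_ident DERIV_cmult) auto
    also have "(1 * hermite v (Suc m) x + (of_nat (Suc m) * hermite v m x) * x)
         - v * of_nat (Suc m) * (of_nat m * hermite v (m - 1) x) =
       hermite v (Suc m) x + of_nat (Suc m) * (x * hermite v m x - v * of_nat m * hermite v (m - 1) x)"
      by (simp add: algebra_simps)
    also have "x * hermite v m x - v * of_nat m * hermite v (m - 1) x = hermite v (Suc m) x"
      unfolding hermite_rec by simp
    finally show ?thesis
      using 3 by (simp add: algebra_simps)
  qed
qed

lemma continuous_hermite [continuous_intros]: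
  fixes v :: "'a::real_normed_field"
  assumes "continuous_on A f"
  shows "continuous_on A (\<lambda>x. hermite v n (f x))"
proof -
  have "continuous_on UNIV (hermite v n)"
    using hermite_deriv[of v n] DERIV_isCont continuous_at_imp_continuous_on by blast
  then show ?thesis
    using assms continuous_on_compose2 by blast
qed

lemma hermite_measurable [measurable]:
  "hermite v n \<in> borel_measurable borel" for v :: "'a::real_normed_field"
  using continuous_hermite[of UNIV id v n] by (intro borel_measurable_continuous_onI) simp

text \<open>
  Needed to insert Hermite polynomials as columns of a Vandermonde determinant.
\<close>
lemma hermite_monic_poly:
  fixes v :: "'a::{comm_ring_1,ring_no_zero_divisors}"
  shows "\<exists>p. degree p = n \<and> coeff p n = 1 \<and> (\<forall>x. poly p x = hermite v n x)"
proof (induction n rule: less_induct)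
  case (less n)
  consider "n = 0" | "n = 1" | m where "n = Suc (Suc m)"
    by (metis One_nat_def not0_implies_Suc)
  then show ?case
  proof cases
    case 1
    then show ?thesis by (intro exI[of _ 1]) simp
  next
    case 2
    then show ?thesis by (intro exI[of _ "[:0, 1:]"]) simp
  next
    case 3
    obtain p q where p: "degree p = m" "\<And>x. poly p x = hermite v m x"
      and q: "degree q = Suc m" "coeff q (Suc m) = 1" "\<And>x. poly q x = hermite v (Suc m) x"
      using less.IH[of m] less.IH[of "Suc m"] 3 by auto
    define r where "r = pCons 0 q - Polynomial.smult (v * of_nat (Suc m)) p"
    have dq: "degree (pCons 0 q) = Suc (Suc m)" using q by (cases "q = 0") auto
    have "degree (Polynomial.smult (v * of_nat (Suc m)) p) < Suc (Suc m)"
      using degree_smult_le[of "v * of_nat (Suc m)" p] p by linarith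
    then have "degree r = Suc (Suc m)"
      unfolding r_def using dq by (metis degree_diff_less degree_add_eq_left diff_conv_add_uminus degree_minus)
    moreover have "coeff r (Suc (Suc m)) = 1"
      using p q by (simp add: r_def coeff_eq_0)
    moreover have "poly r x = hermite v n x" for x
      using 3 p q by (simp add: r_def)
    ultimately show ?thesis using 3 by auto
  qed
qed

section \<open>Orthogonality under a Gaussian weight on the line\<close>

definition gauss_weight :: "real \<Rightarrow> real \<Rightarrow> real" where
  "gauss_weight v y = exp (- y\<^sup>2 / (2 * v))"

lemma gauss_weight_pos [simp]: "gauss_weight v y > 0"
  by (simp add: gauss_weight_def)

lemma abs_gauss_weight [simp]: "\<bar>gauss_weight v y\<bar> = gauss_weight v y"
  by (simp add: gauss_weight_def)

lemma continuous_gauss_weight [continuous_intros]: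
  "continuous_on A f \<Longrightarrow> continuous_on A (\<lambda>x. gauss_weight v (f x))"
  unfolding gauss_weight_def divide_inverse by (intro continuous_intros)

lemma gauss_weight_measurable [measurable]: "gauss_weight v \<in> borel_measurable borel"
  unfolding gauss_weight_def by measurable

lemma gauss_weight_deriv:
  "v \<noteq> 0 \<Longrightarrow> (gauss_weight v has_field_derivative - (y / v) * gauss_weight v y) (at y)"
  unfolding gauss_weight_def by (auto intro!: derivative_eq_intros simp: field_simps)

lemma
  assumes "v > 0"
  shows integrable_gauss_weight: "integrable lborel (gauss_weight v)"
    and integral_gauss_weight: "(LINT y|lborel. gauss_weight v y) = sqrt (2 * pi * v)"
proof -
  have e: "gauss_weight v = (\<lambda>y. sqrt (2 * pi * v) * normal_density 0 (sqrt v) y)"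
    using assms by (auto simp: fun_eq_iff gauss_weight_def normal_density_def)
  show "integrable lborel (gauss_weight v)"
    unfolding e using assms by (intro integrable_mult_right integrable_normal_density) auto
  show "(LINT y|lborel. gauss_weight v y) = sqrt (2 * pi * v)"
    unfolding e using assms by simp
qed

text \<open>
  Growth slower than every Gaussian is inherited by products with \<open>y\<close>, so the recurrence preserves it.
  It settles every question of integrability and of vanishing boundary terms below.
\<close>
lemma hermite_growth:
  fixes v \<epsilon> :: real
  assumes "\<epsilon> > 0"
  shows "\<exists>C\<ge>0. \<forall>y. \<bar>hermite v n y\<bar> \<le> C * exp (\<epsilon> * y\<^sup>2)"
  using assms
proof (induction n arbitrary: \<epsilon> rule: less_induct)
  case (less n)
  have lin: "\<exists>D\<ge>0. \<forall>y. \<bar>y\<bar> \<le> D * exp (\<delta> * y\<^sup>2)" if "\<delta> > 0" for \<delta> :: real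
  proof (intro exI conjI allI)
    fix y :: real
    have "\<bar>y\<bar> \<le> 1 + y\<^sup>2"
    proof -
      have "0 \<le> (\<bar>y\<bar> - 1)\<^sup>2" by simp
      then show ?thesis unfolding power2_diff by (simp add: power2_eq_square)
    qed
    also have "\<dots> \<le> (1 + 1 / \<delta>) * (1 + \<delta> * y\<^sup>2)"
      using that by (simp add: field_simps)
    also have "\<dots> \<le> (1 + 1 / \<delta>) * exp (\<delta> * y\<^sup>2)"
      using that by (intro mult_left_mono exp_ge_add_one_self) auto
    finally show "\<bar>y\<bar> \<le> (1 + 1 / \<delta>) * exp (\<delta> * y\<^sup>2)" .
  qed (use that in auto)
  consider "n = 0" | "n = 1" | m where "n = Suc (Suc m)"
    by (metis One_nat_def not0_implies_Suc)
  then show ?case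
  proof cases
    case 1
    then show ?thesis using less.prems by (intro exI[of _ 1]) auto
  next
    case 2
    then show ?thesis using lin[OF less.prems] by simp
  next
    case 3
    have lt: "m < n" "Suc m < n" using 3 by simp_all
    have h: "\<epsilon> / 2 > 0" using less.prems by simp
    obtain D where D: "D \<ge> 0" "\<And>y. \<bar>y\<bar> \<le> D * exp (\<epsilon> / 2 * y\<^sup>2)" using lin[OF h] by blast
    obtain A where A: "A \<ge> 0" "\<And>y. \<bar>hermite v (Suc m) y\<bar> \<le> A * exp (\<epsilon> / 2 * y\<^sup>2)"
      using less.IH[OF lt(2) h] by blast
    obtain B where B: "B \<ge> 0" "\<And>y. \<bar>hermite v m y\<bar> \<le> B * exp (\<epsilon> * y\<^sup>2)"
      using less.IH[OF lt(1) less.prems] by blast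
    show ?thesis
    proof (intro exI conjI allI)
      fix y
      have "\<bar>hermite v n y\<bar> \<le> \<bar>y\<bar> * \<bar>hermite v (Suc m) y\<bar> + \<bar>v * of_nat (Suc m)\<bar> * \<bar>hermite v m y\<bar>"
        unfolding 3 hermite.simps abs_mult[symmetric] by (rule abs_triangle_ineq4)
      also have "\<dots> \<le> (D * exp (\<epsilon> / 2 * y\<^sup>2)) * (A * exp (\<epsilon> / 2 * y\<^sup>2))
          + \<bar>v * of_nat (Suc m)\<bar> * (B * exp (\<epsilon> * y\<^sup>2))"
        using A B D by (intro add_mono mult_mono) auto
      also have "(D * exp (\<epsilon> / 2 * y\<^sup>2)) * (A * exp (\<epsilon> / 2 * y\<^sup>2)) = D * A * exp (\<epsilon> * y\<^sup>2)"
        by (simp add: mult_exp_exp algebra_simps)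
      also have "D * A * exp (\<epsilon> * y\<^sup>2) + \<bar>v * of_nat (Suc m)\<bar> * (B * exp (\<epsilon> * y\<^sup>2)) =
         (D * A + \<bar>v * of_nat (Suc m)\<bar> * B) * exp (\<epsilon> * y\<^sup>2)"
        by (simp add: algebra_simps)
      finally show "\<bar>hermite v n y\<bar> \<le> (D * A + \<bar>v * of_nat (Suc m)\<bar> * B) * exp (\<epsilon> * y\<^sup>2)" .
    qed (use A B D in auto)
  qed
qed

text \<open>
  Each polynomial costs a factor \<open>exp (y\<^sup>2 / (8v))\<close>, which together use up half of the exponent \<open>y\<^sup>2 / (2v)\<close>.
\<close>
lemma hermite_product_bound:
  assumes "v > 0"
  shows "\<exists>C\<ge>0. \<forall>y. \<bar>hermite u m y * hermite w n y * gauss_weight v y\<bar> \<le> C * gauss_weight (2 * v) y"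
proof -
  have h: "1 / (8 * v) > 0" using assms by simp
  obtain A where A: "A \<ge> 0" "\<And>y. \<bar>hermite u m y\<bar> \<le> A * exp (1 / (8 * v) * y\<^sup>2)"
    using hermite_growth[OF h] by blast
  obtain B where B: "B \<ge> 0" "\<And>y. \<bar>hermite w n y\<bar> \<le> B * exp (1 / (8 * v) * y\<^sup>2)"
    using hermite_growth[OF h] by blast
  show ?thesis
  proof (intro exI conjI allI)
    fix y
    have "\<bar>hermite u m y * hermite w n y * gauss_weight v y\<bar>
       = \<bar>hermite u m y\<bar> * \<bar>hermite w n y\<bar> * gauss_weight v y"
      by (simp add: abs_mult)
    also have "\<dots> \<le> (A * exp (1 / (8 * v) * y\<^sup>2)) * (B * exp (1 / (8 * v) * y\<^sup>2)) * gauss_weight v y"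
      using A B by (intro mult_mono) (auto intro: less_imp_le)
    also have "\<dots> = A * B * (exp (1 / (8 * v) * y\<^sup>2) * exp (1 / (8 * v) * y\<^sup>2) * exp (- y\<^sup>2 / (2 * v)))"
      by (simp add: gauss_weight_def)
    also have "\<dots> = A * B * gauss_weight (2 * v) y"
      unfolding exp_add[symmetric] gauss_weight_def using assms by (simp add: field_simps)
    finally show "\<bar>hermite u m y * hermite w n y * gauss_weight v y\<bar> \<le> A * B * gauss_weight (2 * v) y" .
  qed (use A B in auto)
qed

lemma integrable_hermite_product:
  assumes "v > 0"
  shows "integrable lborel (\<lambda>y. hermite u m y * hermite w n y * gauss_weight v y)"
proof -
  obtain C where C: "C \<ge> 0" "\<And>y. \<bar>hermite u m y * hermite w n y * gauss_weight v y\<bar> \<le> C * gauss_weight (2 * v) y"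
    using hermite_product_bound[OF assms] by blast
  show ?thesis
  proof (rule Bochner_Integration.integrable_bound)
    show "integrable lborel (\<lambda>y. C * gauss_weight (2 * v) y)"
      using assms by (intro integrable_mult_right integrable_gauss_weight) auto
    show "AE y in lborel. norm (hermite u m y * hermite w n y * gauss_weight v y) \<le> norm (C * gauss_weight (2 * v) y)"
      using C by (intro AE_I2) (simp add: abs_mult less_imp_le)
  qed simp
qed

lemma gauss_weight_tendsto_0:
  assumes "v > 0"
  shows "(gauss_weight v \<longlongrightarrow> 0) at_infinity"
proof -
  have "filterlim (\<lambda>y::real. y\<^sup>2 / (2 * v)) at_top at_infinity"
  proof -
    have "filterlim (\<lambda>y::real. norm y ^ 2) at_top at_infinity"
      by (intro filterlim_pow_at_top filterlim_norm_at_top) auto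
    then have "filterlim (\<lambda>y::real. (1 / (2 * v)) * norm y ^ 2) at_top at_infinity"
      using assms by (intro filterlim_tendsto_pos_mult_at_top[OF tendsto_const]) auto
    then show ?thesis by (simp add: mult.commute)
  qed
  then have "((\<lambda>y. exp (- (y\<^sup>2 / (2 * v)))) \<longlongrightarrow> 0) at_infinity"
    by (intro filterlim_compose[OF exp_at_bot] filterlim_uminus_at_bot_at_top[THEN filterlim_compose])
  then show ?thesis unfolding gauss_weight_def by simp
qed

text \<open>
  For positive degree the integrand is an exact derivative: \<open>H\<^sub>m\<^sub>+\<^sub>1\<close> times the weight is the derivative of
  \<open>- v H\<^sub>m\<close> times the weight.
\<close>
lemma integral_hermite_gauss:
  assumes v: "v > 0"
  shows "(LINT y|lborel. hermite v n y * gauss_weight v y) = (if n = 0 then sqrt (2 * pi * v) else 0)"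
proof (cases n)
  case 0
  then show ?thesis using integral_gauss_weight[OF v] by simp
next
  case (Suc m)
  define F where "F y = - v * (hermite v m y * gauss_weight v y)" for y
  have int: "integrable lborel (\<lambda>y. hermite v n y * gauss_weight v y)" for n
    using integrable_hermite_product[OF v, where u = v and m = n and w = v and n = 0] by simp
  have der: "(F has_vector_derivative hermite v (Suc m) y * gauss_weight v y) (at y)" for y
  proof -
    have "(gauss_weight v has_field_derivative - (y / v) * gauss_weight v y) (at y)"
      using v by (intro gauss_weight_deriv) auto
    then have "(F has_field_derivative - v * (of_nat m * hermite v (m - 1) y * gauss_weight v y
         + - (y / v) * gauss_weight v y * hermite v m y)) (at y)"
      unfolding F_def by (intro DERIV_cmult DERIV_mult hermite_deriv)
    also have "- v * (of_nat m * hermite v (m - 1) y * gauss_weight v y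
         + - (y / v) * gauss_weight v y * hermite v m y)
       = (y * hermite v m y - v * of_nat m * hermite v (m - 1) y) * gauss_weight v y"
      using v by (simp add: field_simps)
    also have "y * hermite v m y - v * of_nat m * hermite v (m - 1) y = hermite v (Suc m) y"
      unfolding hermite_rec by simp
    finally show ?thesis by (simp add: has_real_derivative_iff_has_vector_derivative)
  qed
  have lim: "(F \<longlongrightarrow> 0) at_infinity"
  proof -
    obtain C where C: "C \<ge> 0" "\<And>y. \<bar>hermite v m y * hermite v 0 y * gauss_weight v y\<bar> \<le> C * gauss_weight (2 * v) y"
      using hermite_product_bound[OF v] by blast
    have "((\<lambda>y. v * (C * gauss_weight (2 * v) y)) \<longlongrightarrow> v * (C * 0)) at_infinity"
      using v by (intro tendsto_mult tendsto_const gauss_weight_tendsto_0) auto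
    then have "((\<lambda>y. v * (C * gauss_weight (2 * v) y)) \<longlongrightarrow> 0) at_infinity" by simp
    then show ?thesis
    proof (rule Lim_null_comparison[rotated], intro always_eventually allI)
      fix y
      show "norm (F y) \<le> v * (C * gauss_weight (2 * v) y)"
        using C(2)[of y] v unfolding F_def by (simp add: abs_mult)
    qed
  qed
  have "(LBINT y=-\<infinity>..\<infinity>. hermite v (Suc m) y * gauss_weight v y) = 0 - 0"
  proof (rule interval_integral_FTC_integrable[where F = F])
    show "isCont (\<lambda>y. hermite v (Suc m) y * gauss_weight v y) y" for y
      by (rule continuous_on_interior[where S = UNIV])
        (auto simp del: hermite.simps intro!: continuous_intros)
    show "set_integrable lborel (einterval (- \<infinity>) \<infinity>) (\<lambda>y. hermite v (Suc m) y * gauss_weight v y)"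
      using int[of "Suc m"] by (simp add: set_integrable_def del: hermite.simps)
    show "((F \<circ> real_of_ereal) \<longlongrightarrow> 0) (at_right (- \<infinity>))"
      using lim tendsto_mono[OF _ lim, of at_bot] unfolding at_infinity_eq_at_top_bot ereal_tendsto_simps
      by (auto simp: le_sup_iff filterlim_sup)
    show "((F \<circ> real_of_ereal) \<longlongrightarrow> 0) (at_left \<infinity>)"
      using tendsto_mono[OF _ lim, of at_top] unfolding at_infinity_eq_at_top_bot ereal_tendsto_simps
      by (auto simp: le_sup_iff)
  qed (use der in \<open>auto simp del: hermite.simps\<close>)
  then show ?thesis
    using Suc by (simp add: interval_integral_to_infinity_eq interval_lebesgue_integral_def set_lebesgue_integral_def del: hermite.simps)
qed

text \<open>
  Moving the multiplication by \<open>y\<close> from one factor to the other gives a recurrence for the Gram matrix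
  that determines it from its first row, and that row is the preceding lemma.
\<close>
lemma hermite_orthogonal:
  assumes v: "v > 0"
  shows "(LINT y|lborel. hermite v m y * hermite v n y * gauss_weight v y) =
         (if m = n then fact n * v ^ n * sqrt (2 * pi * v) else 0)"
proof -
  define I where "I m n = (LINT y|lborel. hermite v m y * hermite v n y * gauss_weight v y)" for m n
  note int = integrable_hermite_product[OF v]
  have rec: "I (Suc m) n = I m (Suc n) + v * real n * I m (n - 1) - v * real m * I (m - 1) n" for m n
  proof -
    have "I (Suc m) n + v * real m * I (m - 1) n =
        (LINT y|lborel. hermite v (Suc m) y * hermite v n y * gauss_weight v y
           + v * real m * (hermite v (m - 1) y * hermite v n y * gauss_weight v y))"
      unfolding I_def by (simp add: int del: hermite.simps)
    also have "\<dots> = (LINT y|lborel. y * hermite v m y * hermite v n y * gauss_weight v y)"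
      unfolding hermite_rec by (simp add: algebra_simps del: hermite.simps)
    also have "\<dots> = (LINT y|lborel. hermite v m y * (y * hermite v n y) * gauss_weight v y)"
      by (simp add: algebra_simps)
    also have "\<dots> = (LINT y|lborel. hermite v m y * hermite v (Suc n) y * gauss_weight v y
           + v * real n * (hermite v m y * hermite v (n - 1) y * gauss_weight v y))"
      unfolding hermite_rec by (simp add: algebra_simps del: hermite.simps)
    also have "\<dots> = I m (Suc n) + v * real n * I m (n - 1)"
      unfolding I_def by (simp add: int del: hermite.simps)
    finally show ?thesis by simp
  qed
  have "I m n = (if m = n then fact n * v ^ n * sqrt (2 * pi * v) else 0)"
  proof (induction m arbitrary: n rule: less_induct)
    case (less m)
    show ?case
    proof (cases m)
      case 0
      then show ?thesis using integral_hermite_gauss[OF v, of n] by (auto simp: I_def)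
    next
      case (Suc k)
      have IH: "I k j = (if k = j then fact j * v ^ j * sqrt (2 * pi * v) else 0)"
        "I (k - 1) j = (if k - 1 = j then fact j * v ^ j * sqrt (2 * pi * v) else 0)" for j
        using less.IH Suc by auto
      show ?thesis unfolding Suc rec IH
        by (cases n; cases k) (auto simp: algebra_simps)
    qed
  qed
  then show ?thesis by (simp add: I_def)
qed

section \<open>Orthogonality under an anisotropic Gaussian weight on the plane\<close>

text \<open>
  The bridge from the complex plane, as a Euclidean space, to product measures, for which Fubini's theorem
  is available.
\<close>
lemma lborel_complex_eq: "(lborel :: complex measure) = distr (lborel \<Otimes>\<^sub>M lborel) borel (\<lambda>(x, y). Complex x y)"
proof (rule lborel_eqI)
  have m: "(\<lambda>(x, y). Complex x y) \<in> borel_measurable (lborel \<Otimes>\<^sub>M lborel)"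
    unfolding Complex_eq by measurable
  fix l u :: complex
  assume le: "\<And>b. b \<in> Basis \<Longrightarrow> l \<bullet> b \<le> u \<bullet> b"
  have le': "Re l \<le> Re u" "Im l \<le> Im u"
    using le[of 1] le[of \<i>] by (auto simp: Basis_complex_def)
  have "(\<lambda>(x, y). Complex x y) -` box l u \<inter> space (lborel \<Otimes>\<^sub>M lborel) = {Re l<..<Re u} \<times> {Im l<..<Im u}"
    by (auto simp: in_box_complex_iff space_pair_measure)
  then have "emeasure (distr (lborel \<Otimes>\<^sub>M lborel) borel (\<lambda>(x, y). Complex x y)) (box l u) =
      emeasure (lborel \<Otimes>\<^sub>M lborel) ({Re l<..<Re u} \<times> {Im l<..<Im u})"
    using m by (subst emeasure_distr) auto
  also have "\<dots> = ennreal (Re u - Re l) * ennreal (Im u - Im l)"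
    using le' by (subst sigma_finite_measure.emeasure_pair_measure_Times) (auto simp: sigma_finite_lborel)
  also have "\<dots> = (\<Prod>b\<in>Basis. (u - l) \<bullet> b)"
    using le' by (simp add: Basis_complex_def ennreal_mult'')
  finally show "emeasure (distr (lborel \<Otimes>\<^sub>M lborel) borel (\<lambda>(x, y). Complex x y)) (box l u) =
      ennreal (\<Prod>b\<in>Basis. (u - l) \<bullet> b)" .
qed simp

lemma
  fixes f g :: "real \<Rightarrow> real"
  assumes f: "integrable lborel f" and g: "integrable lborel g"
  shows integrable_Re_Im_product: "integrable lborel (\<lambda>z::complex. f (Re z) * g (Im z))"
    and integral_Re_Im_product: "(LINT z|lborel. f (Re z) * g (Im z)) = (LINT x|lborel. f x) * (LINT y|lborel. g y)"
proof -
  note [measurable] = borel_measurable_integrable[OF f] borel_measurable_integrable[OF g]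
  have m: "(\<lambda>(x, y). Complex x y) \<in> lborel \<Otimes>\<^sub>M lborel \<rightarrow>\<^sub>M borel"
    unfolding Complex_eq by measurable
  have h: "(\<lambda>z::complex. f (Re z) * g (Im z)) \<in> borel_measurable borel" by measurable
  have e: "(\<lambda>p. f (Re ((\<lambda>(x, y). Complex x y) p)) * g (Im ((\<lambda>(x, y). Complex x y) p))) = (\<lambda>(x, y). f x * g y)"
    by auto
  have "integrable (lborel \<Otimes>\<^sub>M lborel) (\<lambda>(x, y). f x * g y)"
    by (intro lborel_pair.Fubini_integrable) (use f g in \<open>auto simp: abs_mult\<close>)
  note int = this
  show "integrable lborel (\<lambda>z::complex. f (Re z) * g (Im z))"
    unfolding lborel_complex_eq integrable_distr_eq[OF m h] e by (rule int)
  show "(LINT z|lborel. f (Re z) * g (Im z)) = (LINT x|lborel. f x) * (LINT y|lborel. g y)"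
    unfolding lborel_complex_eq integral_distr[OF m h] e lborel_pair.integral_fst'[OF int, symmetric]
    by simp
qed

text \<open>
  The binomial theorem after cancelling \<open>k! (n - k)! (n choose k) = n!\<close>; this is how the two variances
  add up in the norms of the planar polynomials.
\<close>
lemma binomial_fact_sum:
  fixes v w :: real
  shows "(\<Sum>k\<le>n. (real (n choose k))\<^sup>2 * (fact k * v ^ k) * (fact (n - k) * w ^ (n - k))) = fact n * (v + w) ^ n"
proof -
  have "(real (n choose k))\<^sup>2 * (fact k * v ^ k) * (fact (n - k) * w ^ (n - k)) =
      fact n * (real (n choose k) * v ^ k * w ^ (n - k))" if "k \<le> n" for k
  proof -
    have "fact k * fact (n - k) * real (n choose k) = fact n"
      using binomial_fact_lemma[OF that] by (metis of_nat_fact of_nat_mult)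
    then have "real (n choose k) * (fact k * fact (n - k)) = fact n" by (simp only: ac_simps)
    then show ?thesis by (simp add: power2_eq_square)
  qed
  then show ?thesis
    unfolding binomial_ring sum_distrib_left by (intro sum.cong) auto
qed

definition aniso_weight :: "real \<Rightarrow> real \<Rightarrow> complex \<Rightarrow> real" where
  "aniso_weight v w z = gauss_weight v (Re z) * gauss_weight w (Im z)"

text \<open>
  The coefficients of the expansion \<open>hermite_complex_expansion\<close>.
\<close>
definition expansion_coeff :: "nat \<Rightarrow> nat \<Rightarrow> complex" where
  "expansion_coeff n k = of_nat (n choose k) * \<i> ^ (n - k)"

lemma hermite_product_expansion:
  "hermite (of_real (v - w)) m (Complex x y) * cnj (hermite (of_real (v - w)) n (Complex x y)) =
   (\<Sum>k\<le>m. \<Sum>l\<le>n. (expansion_coeff m k * cnj (expansion_coeff n l)) *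
      of_real ((hermite v k x * hermite v l x) * (hermite w (m - k) y * hermite w (n - l) y)))"
  unfolding hermite_complex_expansion cnj_sum sum_product expansion_coeff_def
  by (intro sum.cong refl) simp

lemma expansion_coeff_norm: "expansion_coeff n k * cnj (expansion_coeff n k) = of_real ((real (n choose k))\<^sup>2)"
proof -
  have "\<i> ^ j * (- \<i>) ^ j = 1" for j by (simp flip: power_mult_distrib)
  then show ?thesis
    by (simp add: expansion_coeff_def power2_eq_square)
qed

text \<open>
  In the double expansion only equal indices survive in the real direction and only equal complementary
  indices in the imaginary one; if the degrees differ, both cannot happen at once.
\<close>
lemma
  assumes v: "v > 0" and w: "w > 0"
  shows integrable_hermite_aniso: "integrable lborel (\<lambda>z. hermite (of_real (v - w)) m z *
      cnj (hermite (of_real (v - w)) n z) * of_real (aniso_weight v w z))" (is ?A)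
    and hermite_aniso_orthogonal: "(LINT z|lborel. hermite (of_real (v - w)) m z *
      cnj (hermite (of_real (v - w)) n z) * of_real (aniso_weight v w z)) =
      (if m = n then of_real (2 * pi * sqrt (v * w) * (fact n * (v + w) ^ n)) else 0)" (is ?B)
proof -
  define F where "F k l z = (hermite v k (Re z) * hermite v l (Re z) * gauss_weight v (Re z)) *
      (hermite w (m - k) (Im z) * hermite w (n - l) (Im z) * gauss_weight w (Im z))" for k l z
  have intF: "integrable lborel (F k l)" for k l
    unfolding F_def by (intro integrable_Re_Im_product integrable_hermite_product v w)
  have e: "hermite (of_real (v - w)) m z * cnj (hermite (of_real (v - w)) n z) * of_real (aniso_weight v w z)
     = (\<Sum>k\<le>m. \<Sum>l\<le>n. (expansion_coeff m k * cnj (expansion_coeff n l)) * of_real (F k l z))" for z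
  proof (cases z)
    case (Complex x y)
    show ?thesis unfolding Complex hermite_product_expansion sum_distrib_right
      by (intro sum.cong refl) (simp add: F_def aniso_weight_def)
  qed
  show ?A unfolding e
    by (intro Bochner_Integration.integrable_sum integrable_mult_right integrable_of_real intF)
  have LF: "(LINT z|lborel. F k l z) = (if k = l \<and> m - k = n - l then
     (fact k * v ^ k * sqrt (2 * pi * v)) * (fact (n - l) * w ^ (n - l) * sqrt (2 * pi * w)) else 0)" for k l
    unfolding F_def
    by (subst integral_Re_Im_product) (simp_all add: integrable_hermite_product v w hermite_orthogonal)
  have "(LINT z|lborel. hermite (of_real (v - w)) m z *
      cnj (hermite (of_real (v - w)) n z) * of_real (aniso_weight v w z)) =
     (\<Sum>k\<le>m. \<Sum>l\<le>n. (expansion_coeff m k * cnj (expansion_coeff n l)) * of_real (LINT z|lborel. F k l z))"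
    unfolding e
    by (subst Bochner_Integration.integral_sum; (intro Bochner_Integration.integrable_sum integrable_mult_right integrable_of_real intF)?)
      (intro sum.cong refl, subst Bochner_Integration.integral_sum;
         (intro integrable_mult_right integrable_of_real intF sum.cong refl)?; simp)
  also have "\<dots> = (if m = n then of_real (2 * pi * sqrt (v * w) * (fact n * (v + w) ^ n)) else 0)"
  proof (cases "m = n")
    case False
    then have "(LINT z|lborel. F k l z) = 0" if "k \<le> m" "l \<le> n" for k l
      unfolding LF using that by auto
    then show ?thesis using False by simp
  next
    case True
    have s: "sqrt (2 * pi * v) * sqrt (2 * pi * w) = 2 * pi * sqrt (v * w)"
    proof -
      have "sqrt (2 * pi * v) * sqrt (2 * pi * w) = sqrt ((2 * pi)\<^sup>2 * (v * w))"
        unfolding real_sqrt_mult[symmetric] by (simp add: power2_eq_square ac_simps)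
      then show ?thesis by (simp add: real_sqrt_mult)
    qed
    have "(\<Sum>l\<le>n. (expansion_coeff m k * cnj (expansion_coeff n l)) * of_real (LINT z|lborel. F k l z)) =
        of_real (2 * pi * sqrt (v * w) * ((real (n choose k))\<^sup>2 * (fact k * v ^ k) * (fact (n - k) * w ^ (n - k))))" if "k \<le> n" for k
    proof -
      have "(\<Sum>l\<le>n. (expansion_coeff m k * cnj (expansion_coeff n l)) * of_real (LINT z|lborel. F k l z)) =
        (\<Sum>l\<le>n. if l = k then of_real ((real (n choose k))\<^sup>2 * ((fact k * v ^ k * sqrt (2 * pi * v)) * (fact (n - k) * w ^ (n - k) * sqrt (2 * pi * w)))) else 0)"
        unfolding LF by (intro sum.cong refl) (auto simp: True expansion_coeff_norm)
      also have "\<dots> = of_real ((real (n choose k))\<^sup>2 * ((fact k * v ^ k * sqrt (2 * pi * v)) * (fact (n - k) * w ^ (n - k) * sqrt (2 * pi * w))))"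
        using that by simp
      also have "(real (n choose k))\<^sup>2 * ((fact k * v ^ k * sqrt (2 * pi * v)) * (fact (n - k) * w ^ (n - k) * sqrt (2 * pi * w)))
        = 2 * pi * sqrt (v * w) * ((real (n choose k))\<^sup>2 * (fact k * v ^ k) * (fact (n - k) * w ^ (n - k)))"
        unfolding s[symmetric] by (simp add: ac_simps)
      finally show ?thesis .
    qed
    then have "(\<Sum>k\<le>m. \<Sum>l\<le>n. (expansion_coeff m k * cnj (expansion_coeff n l)) * of_real (LINT z|lborel. F k l z)) =
      of_real (2 * pi * sqrt (v * w) * (\<Sum>k\<le>n. (real (n choose k))\<^sup>2 * (fact k * v ^ k) * (fact (n - k) * w ^ (n - k))))"
      by (simp add: True sum_distrib_left)
    then show ?thesis using True by (simp only: binomial_fact_sum if_True refl)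
  qed
  finally show ?B .
qed

text \<open>
  Integrating over the imaginary part alone already makes the expansion diagonal: what remains is a positive
  combination of squared one-dimensional Hermite polynomials of the real part.
\<close>
lemma
  assumes w: "w > 0"
  shows integrable_hermite_vertical: "integrable lborel (\<lambda>y. (cmod (hermite (of_real (v - w)) n (Complex x y)))\<^sup>2 * gauss_weight w y)" (is ?A)
    and integral_hermite_vertical: "(LINT y|lborel. (cmod (hermite (of_real (v - w)) n (Complex x y)))\<^sup>2 * gauss_weight w y) =
      sqrt (2 * pi * w) * (\<Sum>k\<le>n. (real (n choose k))\<^sup>2 * (fact (n - k) * w ^ (n - k)) * (hermite v k x)\<^sup>2)" (is ?B)
proof -
  define F where "F k l y = hermite w (n - k) y * hermite w (n - l) y * gauss_weight w y" for k l y
  define a where "a k l = Re (expansion_coeff n k * cnj (expansion_coeff n l)) * (hermite v k x * hermite v l x)" for k l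
  have intF: "integrable lborel (F k l)" for k l
    unfolding F_def by (intro integrable_hermite_product w)
  have e: "(cmod (hermite (of_real (v - w)) n (Complex x y)))\<^sup>2 * gauss_weight w y = (\<Sum>k\<le>n. \<Sum>l\<le>n. a k l * F k l y)" for y
  proof -
    have "(cmod (hermite (of_real (v - w)) n (Complex x y)))\<^sup>2 = Re (hermite (of_real (v - w)) n (Complex x y) * cnj (hermite (of_real (v - w)) n (Complex x y)))"
      by (simp only: complex_norm_square[symmetric] Re_complex_of_real)
    also have "\<dots> = (\<Sum>k\<le>n. \<Sum>l\<le>n. a k l * (hermite w (n - k) y * hermite w (n - l) y))"
      unfolding hermite_product_expansion Re_sum a_def
      by (intro sum.cong refl) (simp add: algebra_simps)
    finally show ?thesis by (simp add: sum_distrib_right F_def mult.assoc)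
  qed
  show ?A unfolding e
    by (intro Bochner_Integration.integrable_sum integrable_mult_right intF)
  have "(LINT y|lborel. (cmod (hermite (of_real (v - w)) n (Complex x y)))\<^sup>2 * gauss_weight w y) =
      (\<Sum>k\<le>n. \<Sum>l\<le>n. a k l * (LINT y|lborel. F k l y))"
    unfolding e
    by (subst Bochner_Integration.integral_sum; (intro Bochner_Integration.integrable_sum integrable_mult_right intF)?)
      (intro sum.cong refl, subst Bochner_Integration.integral_sum;
         (intro integrable_mult_right intF sum.cong refl)?; simp)
  also have "\<dots> = (\<Sum>k\<le>n. \<Sum>l\<le>n. if l = k then a k k * (fact (n - k) * w ^ (n - k) * sqrt (2 * pi * w)) else 0)"
    unfolding F_def hermite_orthogonal[OF w] by (intro sum.cong refl) auto
  also have "\<dots> = (\<Sum>k\<le>n. a k k * (fact (n - k) * w ^ (n - k) * sqrt (2 * pi * w)))"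
    by (intro sum.cong refl) (simp add: sum.delta')
  also have "\<dots> = sqrt (2 * pi * w) * (\<Sum>k\<le>n. (real (n choose k))\<^sup>2 * (fact (n - k) * w ^ (n - k)) * (hermite v k x)\<^sup>2)"
    unfolding sum_distrib_left a_def expansion_coeff_norm Re_complex_of_real
    by (intro sum.cong refl) (simp add: power2_eq_square ac_simps)
  finally show ?B .
qed

section \<open>Determinantal form of planar Gibbs measures\<close>

text \<open>
  As a function of the last point the determinant is a polynomial that vanishes at the other
  points (two equal rows) and whose leading coefficient is, by expansion along the last row, the determinant
  of the smaller system. This identifies it as long as the other points are distinct; otherwise both sides
  vanish.
\<close>
lemma det_monic_polynomials:
  fixes P :: "nat \<Rightarrow> 'a::field poly"
  assumes P: "\<And>k. degree (P k) = k" "\<And>k. coeff (P k) k = 1"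
  shows "Determinant.det (mat n n (\<lambda>(i, j). poly (P j) (z i))) = (\<Prod>i<n. \<Prod>j<i. z i - z j)"
proof (induction n)
  case 0
  then show ?case by (simp add: det_dim_zero)
next
  case (Suc n)
  \<comment> \<open>The matrix with the last point replaced by a variable; its last-row cofactors stay constant.\<close>
  define A where "A u = mat (Suc n) (Suc n) (\<lambda>(i, j). poly (P j) ((z(n := u)) i))" for u
  define c where "c j = cofactor (A (z n)) n j" for j
  have A: "A u \<in> carrier_mat (Suc n) (Suc n)" for u by (simp add: A_def)
  have cof: "cofactor (A u) n j = c j" if "j < Suc n" for u j
  proof -
    have "mat_delete (A u) n j = mat_delete (A (z n)) n j"
      unfolding mat_delete_def A_def by (intro eq_matI) auto
    then show ?thesis by (simp add: c_def cofactor_def)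
  qed
  define R where "R = (\<Sum>j<Suc n. Polynomial.smult (c j) (P j))"
  have R: "poly R u = Determinant.det (A u)" for u
  proof -
    have "Determinant.det (A u) = (\<Sum>j<Suc n. A u $$ (n, j) * cofactor (A u) n j)"
      by (rule laplace_expansion_row[OF A]) simp
    also have "\<dots> = (\<Sum>j<Suc n. c j * poly (P j) u)"
      by (intro sum.cong refl) (simp only: cof lessThan_iff, simp add: A_def)
    also have "\<dots> = poly R u" by (simp only: R_def poly_sum poly_smult)
    finally show ?thesis ..
  qed
  have root: "poly R (z i) = 0" if i: "i < n" for i
  proof -
    have "row (A (z i)) i = row (A (z i)) n"
      using i by (intro eq_vecI) (auto simp: A_def)
    then show ?thesis unfolding R using i by (intro det_identical_rows[OF A, of i n]) auto
  qed
  have cn: "c n = (\<Prod>i<n. \<Prod>j<i. z i - z j)"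
  proof -
    have "mat_delete (A (z n)) n n = mat n n (\<lambda>(i, j). poly (P j) (z i))"
      unfolding mat_delete_def A_def by (intro eq_matI) auto
    then show ?thesis by (simp add: c_def cofactor_def Suc.IH)
  qed
  have An: "mat (Suc n) (Suc n) (\<lambda>(i, j). poly (P j) (z i)) = A (z n)"
    by (simp add: A_def)
  have "poly R (z n) = c n * (\<Prod>j<n. z n - z j)"
  proof (cases "inj_on z {..<n}")
    case True
    define V where "V = Polynomial.smult (c n) (\<Prod>j<n. [:- z j, 1:])"
    have dV: "degree (\<Prod>j<n. [:- z j, 1:]) = n" "lead_coeff (\<Prod>j<n. [:- z j, 1:]) = 1"
      by (subst degree_prod_sum_eq) (auto simp: lead_coeff_prod)
    have "R = V"
    proof (rule poly_eqI_degree_lead_coeff)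
      show "coeff R n = coeff V n"
      proof -
        have "coeff R n = (\<Sum>j<Suc n. if j = n then c n else 0)"
          unfolding R_def coeff_sum using P by (intro sum.cong refl) (auto simp: coeff_eq_0)
        then show ?thesis using dV by (simp add: V_def)
      qed
      show "card (z ` {..<n}) \<ge> n" using True by (simp add: card_image)
      show "degree R \<le> n"
        unfolding R_def using P(1) by (intro degree_sum_le) (auto intro: order_trans[OF degree_smult_le])
      show "degree V \<le> n"
        unfolding V_def using dV degree_smult_le[of "c n"] by metis
      show "poly R x = poly V x" if "x \<in> z ` {..<n}" for x
        using that root by (auto simp: V_def poly_prod)
    qed
    then show ?thesis by (simp add: V_def poly_prod)
  next
    case False
    then obtain i j where ij: "i < n" "j < n" "i \<noteq> j" "z i = z j" by (auto simp: inj_on_def)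
    have "row (A (z n)) i = row (A (z n)) j"
      using ij by (intro eq_vecI) (auto simp: A_def)
    then have "poly R (z n) = 0"
      unfolding R using ij by (intro det_identical_rows[OF A, of i j]) auto
    moreover have "c n = 0"
    proof -
      have "\<exists>a b. b < a \<and> a < n \<and> z a = z b" using ij by (metis nat_neq_iff)
      then show ?thesis unfolding cn by (auto intro!: prod_zero bexI)
    qed
    ultimately show ?thesis by simp
  qed
  then show ?case
    unfolding An R[symmetric] cn by (simp add: mult.commute)
qed

lemma prod_offdiagonal_symmetric:
  fixes f :: "nat \<Rightarrow> nat \<Rightarrow> 'a::comm_monoid_mult"
  assumes "\<And>j k. f j k = f k j"
  shows "(\<Prod>j<n. \<Prod>k\<in>{..<n} - {j}. f j k) = (\<Prod>j<n. \<Prod>k<j. f j k) ^ 2"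
proof (induction n)
  case (Suc n)
  have "(\<Prod>j<Suc n. \<Prod>k\<in>{..<Suc n} - {j}. f j k) =
     (\<Prod>j<n. \<Prod>k\<in>{..<Suc n} - {j}. f j k) * (\<Prod>k<n. f n k)"
    by (simp add: lessThan_Suc mult.commute)
  also have "(\<Prod>j<n. \<Prod>k\<in>{..<Suc n} - {j}. f j k) = (\<Prod>j<n. f j n * (\<Prod>k\<in>{..<n} - {j}. f j k))"
  proof (rule prod.cong)
    fix j assume "j \<in> {..<n}"
    then have "{..<Suc n} - {j} = insert n ({..<n} - {j})" by auto
    then show "(\<Prod>k\<in>{..<Suc n} - {j}. f j k) = f j n * (\<Prod>k\<in>{..<n} - {j}. f j k)" by simp
  qed simp
  also have "\<dots> = (\<Prod>k<n. f n k) * (\<Prod>j<n. \<Prod>k<j. f j k) ^ 2"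
    unfolding prod.distrib Suc.IH using assms by simp
  finally show ?case by (simp add: power2_eq_square ac_simps)
qed simp

text \<open>
  Distinctness of the points matters: on the diagonals the logarithm of \<open>1/0\<close> is \<open>0\<close> by convention, so the left-hand side
  stays positive there while the right-hand side vanishes.
\<close>
lemma exp_minus_energy:
  assumes P: "\<And>k. degree (P k) = k" "\<And>k. coeff (P k) k = 1" and inj: "inj_on \<zeta> {..<N}"
  shows "exp (- energy Q N \<zeta>) =
    (cmod (Determinant.det (mat N N (\<lambda>(i, j). poly (P j) (\<zeta> i)))))\<^sup>2 * (\<Prod>j<N. exp (- (real N * Q (\<zeta> j))))"
proof -
  have "exp (- energy Q N \<zeta>) =
      (\<Prod>j<N. \<Prod>k\<in>{..<N} - {j}. exp (- ln (1 / cmod (\<zeta> j - \<zeta> k)))) * (\<Prod>j<N. exp (- (real N * Q (\<zeta> j))))"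
  proof -
    have "- energy Q N \<zeta> = (\<Sum>j<N. \<Sum>k\<in>{..<N} - {j}. - ln (1 / cmod (\<zeta> j - \<zeta> k))) + (\<Sum>j<N. - (real N * Q (\<zeta> j)))"
      by (simp add: energy_def sum_negf sum_distrib_left)
    then show ?thesis by (simp only: exp_add exp_sum finite_lessThan finite_Diff)
  qed
  also have "(\<Prod>j<N. \<Prod>k\<in>{..<N} - {j}. exp (- ln (1 / cmod (\<zeta> j - \<zeta> k)))) =
      (\<Prod>j<N. \<Prod>k\<in>{..<N} - {j}. cmod (\<zeta> j - \<zeta> k))"
  proof (intro prod.cong refl)
    fix j k assume "j \<in> {..<N}" "k \<in> {..<N} - {j}"
    then have "cmod (\<zeta> j - \<zeta> k) > 0" using inj by (auto simp: inj_on_def)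
    then show "exp (- ln (1 / cmod (\<zeta> j - \<zeta> k))) = cmod (\<zeta> j - \<zeta> k)"
      by (simp add: ln_div)
  qed
  also have "\<dots> = (\<Prod>j<N. \<Prod>k<j. cmod (\<zeta> j - \<zeta> k))\<^sup>2"
    by (rule prod_offdiagonal_symmetric) (rule norm_minus_commute)
  also have "(\<Prod>j<N. \<Prod>k<j. cmod (\<zeta> j - \<zeta> k)) = cmod (Determinant.det (mat N N (\<lambda>(i, j). poly (P j) (\<zeta> i))))"
    unfolding det_monic_polynomials[of P, OF P] by (simp add: prod_norm)
  finally show ?thesis .
qed

lemma sets_dA [simp, measurable_cong]: "sets dA = sets borel" and space_dA [simp]: "space dA = UNIV"
  by (simp_all add: dA_def)

lemma sigma_finite_dA: "sigma_finite_measure dA"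
  unfolding dA_def by (intro sigma_finite_measure.sigma_finite_iff_density_finite[THEN iffD2] sigma_finite_lborel) auto

interpretation dA: product_sigma_finite "\<lambda>_::nat. dA"
  by (simp add: product_sigma_finite_def sigma_finite_dA)

lemma integral_dA:
  fixes f :: "complex \<Rightarrow> 'b::{banach, second_countable_topology}"
  assumes "f \<in> borel_measurable borel"
  shows "integral\<^sup>L dA f = (1 / pi) *\<^sub>R integral\<^sup>L lborel f"
    and "integrable dA f \<longleftrightarrow> integrable lborel f"
proof -
  show "integral\<^sup>L dA f = (1 / pi) *\<^sub>R integral\<^sup>L lborel f"
    unfolding dA_def using assms by (subst integral_density) auto
  show "integrable dA f \<longleftrightarrow> integrable lborel f"
  proof -
    have "integrable dA f \<longleftrightarrow> integrable lborel (\<lambda>x. (1 / pi) *\<^sub>R f x)"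
      unfolding dA_def using assms by (subst integrable_density) auto
    also have "\<dots> \<longleftrightarrow> integrable lborel f"
    proof
      assume "integrable lborel (\<lambda>x. (1 / pi) *\<^sub>R f x)"
      then have "integrable lborel (\<lambda>x. pi *\<^sub>R ((1 / pi) *\<^sub>R f x))" by (rule integrable_scaleR_right)
      then show "integrable lborel f" by simp
    qed simp
    finally show ?thesis .
  qed
qed

lemma emeasure_dA_point: "emeasure dA {x} = 0"
  unfolding dA_def by (subst emeasure_density) (auto simp: nn_integral_null_set)

lemma borel_measurable_dA: "borel_measurable dA = borel_measurable borel"
  by (rule measurable_cong_sets) simp_all

lemma dA_prod_component_measurable:
  assumes "k < N"
  shows "(\<lambda>\<zeta>. \<zeta> k) \<in> borel_measurable (dA_prod N)"
proof -
  have "(\<lambda>\<zeta>. \<zeta> k) \<in> PiM {..<N} (\<lambda>_. dA) \<rightarrow>\<^sub>M dA"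
    using assms by (intro measurable_component_singleton) simp
  moreover have "PiM {..<N} (\<lambda>_. dA) \<rightarrow>\<^sub>M dA = borel_measurable (PiM {..<N} (\<lambda>_. dA))"
    by (rule measurable_cong_sets) simp_all
  ultimately show ?thesis by (simp add: dA_prod_def)
qed

text \<open>
  By Fubini each diagonal \<open>\<zeta> i = \<zeta> j\<close> is null, since for fixed \<open>\<zeta> j\<close> the section is a single point.
\<close>
lemma AE_dA_prod_inj: "AE \<zeta> in dA_prod N. inj_on \<zeta> {..<N}"
proof -
  have "AE \<zeta> in dA_prod N. \<zeta> i \<noteq> \<zeta> j" if ij: "i < N" "j < N" "i \<noteq> j" for i j
  proof -
    define I where "I = {..<N} - {i}"
    have I: "finite I" "i \<notin> I" "insert i I = {..<N}" using ij by (auto simp: I_def)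
    have jI: "j \<in> I" using ij by (simp add: I_def)
    have m: "{\<zeta> \<in> space (dA_prod N). \<zeta> i = \<zeta> j} \<in> sets (dA_prod N)"
      using dA_prod_component_measurable[OF ij(1)] dA_prod_component_measurable[OF ij(2)] by measurable
    define f where "f = (indicator {\<zeta> \<in> space (dA_prod N). \<zeta> i = \<zeta> j} :: _ \<Rightarrow> ennreal)"
    have fm: "f \<in> borel_measurable (PiM (insert i I) (\<lambda>_. dA))"
      unfolding f_def using m I by (auto simp: dA_prod_def)
    have "emeasure (dA_prod N) {\<zeta> \<in> space (dA_prod N). \<zeta> i = \<zeta> j} = integral\<^sup>N (PiM (insert i I) (\<lambda>_. dA)) f"
      unfolding f_def using m I by (simp add: dA_prod_def)
    also have "\<dots> = (\<integral>\<^sup>+ x. (\<integral>\<^sup>+ y. f (x(i := y)) \<partial>dA) \<partial>(PiM I (\<lambda>_. dA)))"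
      by (rule dA.product_nn_integral_insert[OF I(1,2) fm])
    also have "\<dots> = (\<integral>\<^sup>+ x. 0 \<partial>(PiM I (\<lambda>_. dA)))"
    proof (rule nn_integral_cong)
      fix x
      have "(\<integral>\<^sup>+ y. f (x(i := y)) \<partial>dA) \<le> (\<integral>\<^sup>+ y. indicator {x j} y \<partial>dA)"
        unfolding f_def using ij by (intro nn_integral_mono) (auto simp: indicator_def)
      also have "\<dots> = 0" by (simp add: emeasure_dA_point)
      finally show "(\<integral>\<^sup>+ y. f (x(i := y)) \<partial>dA) = 0" by simp
    qed
    finally have "emeasure (dA_prod N) {\<zeta> \<in> space (dA_prod N). \<zeta> i = \<zeta> j} = 0" by simp
    then show ?thesis using m by (intro AE_I[OF _ _ m]) auto
  qed
  then have "AE \<zeta> in dA_prod N. \<forall>i\<in>{..<N}. \<forall>j\<in>{..<N}. i \<noteq> j \<longrightarrow> \<zeta> i \<noteq> \<zeta> j"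
    by (intro AE_finite_allI) (auto simp: AE_conj_iff)
  then show ?thesis by eventually_elim (auto simp: inj_on_def)
qed

text \<open>
  All that enters about the potential is a family of monic orthogonal polynomials for its weight; the
  potential itself may depend on \<open>N\<close>.
\<close>
locale planar_orthogonal_polynomials =
  fixes P :: "nat \<Rightarrow> complex poly" and Q :: "complex \<Rightarrow> real" and N :: nat and h :: "nat \<Rightarrow> real"
  assumes degree_P: "degree (P k) = k"
    and monic_P: "coeff (P k) k = 1"
    and Q_measurable [measurable]: "Q \<in> borel_measurable borel"
    and N_pos: "N > 0"
    and h_pos: "h k > 0"
    and integrable_P: "integrable dA (\<lambda>z. poly (P m) z * cnj (poly (P n) z) * of_real (exp (- (real N * Q z))))"
    and orthogonal_P: "(LINT z|dA. poly (P m) z * cnj (poly (P n) z) * of_real (exp (- (real N * Q z)))) =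
      (if m = n then of_real (h n) else 0)"
begin

definition weight :: "complex \<Rightarrow> real" where "weight z = exp (- (real N * Q z))"

lemma weight_pos [simp]: "weight z > 0" by (simp add: weight_def)

lemma weight_measurable [measurable]: "weight \<in> borel_measurable borel"
  unfolding weight_def by measurable

lemma P_measurable [measurable]: "poly (P m) \<in> borel_measurable borel"
  by (intro borel_measurable_continuous_onI continuous_intros)

text \<open>
  The Gram matrix of the orthogonal polynomials restricted to a test set \<open>S\<close>; one of the particles will be
  required to lie in \<open>S\<close>.
\<close>
definition moment :: "complex set \<Rightarrow> nat \<Rightarrow> nat \<Rightarrow> complex" where
  "moment S m n = (LINT z|dA. poly (P m) z * cnj (poly (P n) z) * of_real (weight z) * of_real (indicator S z))"

lemma integrable_moment:
  assumes [measurable]: "S \<in> sets borel"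
  shows "integrable dA (\<lambda>z. poly (P m) z * cnj (poly (P n) z) * of_real (weight z) * of_real (indicator S z))"
proof (rule Bochner_Integration.integrable_bound[OF integrable_P[of m n]])
  have [measurable]: "cnj \<in> borel_measurable borel"
    by (intro borel_measurable_continuous_onI continuous_intros)
  show "(\<lambda>z. poly (P m) z * cnj (poly (P n) z) * of_real (weight z) * of_real (indicator S z)) \<in> borel_measurable dA"
    unfolding borel_measurable_dA by measurable
qed (auto simp: weight_def indicator_def norm_mult)

lemma moment_UNIV: "moment UNIV m n = (if m = n then of_real (h n) else 0)"
  using orthogonal_P[of m n] unfolding moment_def weight_def by simp

text \<open>
  The factor belonging to particle \<open>j\<close> in the product of the \<open>\<sigma>\<close>-term of the determinant with the conjugate of its
  \<open>\<tau>\<close>-term; the test set constrains particle \<open>i\<close> only.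
\<close>
definition leibniz_term :: "complex set \<Rightarrow> nat \<Rightarrow> (nat \<Rightarrow> nat) \<Rightarrow> (nat \<Rightarrow> nat) \<Rightarrow> nat \<Rightarrow> complex \<Rightarrow> complex" where
  "leibniz_term S i \<sigma> \<tau> j z = poly (P (\<sigma> j)) z * cnj (poly (P (\<tau> j)) z) * of_real (weight z) *
     of_real (indicator (if j = i then S else UNIV) z)"

lemma gibbs_weight_expansion:
  assumes inj: "inj_on \<zeta> {..<N}" and i: "i < N"
  shows "of_real (exp (- energy Q N \<zeta>) * indicator S (\<zeta> i)) =
    (\<Sum>\<sigma> | \<sigma> permutes {..<N}. \<Sum>\<tau> | \<tau> permutes {..<N}.
       signof \<sigma> * signof \<tau> * (\<Prod>j<N. leibniz_term S i \<sigma> \<tau> j (\<zeta> j)))"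
proof -
  define D where "D = Determinant.det (mat N N (\<lambda>(i, j). poly (P j) (\<zeta> i)))"
  have D: "D = (\<Sum>\<sigma> | \<sigma> permutes {..<N}. signof \<sigma> * (\<Prod>j<N. poly (P (\<sigma> j)) (\<zeta> j)))"
  proof -
    have "D = (\<Sum>\<sigma> | \<sigma> permutes {0..<N}. signof \<sigma> * (\<Prod>j = 0..<N. mat N N (\<lambda>(i, j). poly (P j) (\<zeta> i)) $$ (j, \<sigma> j)))"
      unfolding D_def by (rule det_def') simp
    also have "\<dots> = (\<Sum>\<sigma> | \<sigma> permutes {0..<N}. signof \<sigma> * (\<Prod>j = 0..<N. poly (P (\<sigma> j)) (\<zeta> j)))"
    proof (intro sum.cong prod.cong refl arg_cong2[of _ _ _ _ "(*)"])
      fix \<sigma> j assume s: "\<sigma> \<in> {\<sigma>. \<sigma> permutes {0..<N}}" and j: "j \<in> {0..<N}"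
      have "\<sigma> j < N" using s j permutes_in_image[of \<sigma> "{0..<N}" j] by auto
      then show "mat N N (\<lambda>(i, j). poly (P j) (\<zeta> i)) $$ (j, \<sigma> j) = poly (P (\<sigma> j)) (\<zeta> j)"
        using j by simp
    qed
    finally show ?thesis by (simp add: atLeast0LessThan)
  qed
  have ind: "of_real (indicator S (\<zeta> i)) = (\<Prod>j<N. of_real (indicator (if j = i then S else UNIV) (\<zeta> j)) :: complex)"
  proof -
    have "(\<Prod>j<N. of_real (indicator (if j = i then S else UNIV) (\<zeta> j)) :: complex) =
      (\<Prod>j<N. if j = i then of_real (indicator S (\<zeta> i)) else 1)"
      by (intro prod.cong) auto
    then show ?thesis using i by simp
  qed
  have "of_real (exp (- energy Q N \<zeta>) * indicator S (\<zeta> i)) =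
     D * cnj D * (\<Prod>j<N. of_real (weight (\<zeta> j))) * (\<Prod>j<N. of_real (indicator (if j = i then S else UNIV) (\<zeta> j)))"
    unfolding exp_minus_energy[of P, OF degree_P monic_P inj] D_def[symmetric] of_real_mult ind
      complex_norm_square weight_def of_real_prod ..
  also have "D * cnj D = (\<Sum>\<sigma> | \<sigma> permutes {..<N}. \<Sum>\<tau> | \<tau> permutes {..<N}.
       (signof \<sigma> * (\<Prod>j<N. poly (P (\<sigma> j)) (\<zeta> j))) * (signof \<tau> * (\<Prod>j<N. cnj (poly (P (\<tau> j)) (\<zeta> j)))))"
    unfolding D cnj_sum sum_product by (simp add: cnj_prod)
  finally show ?thesis
    unfolding sum_distrib_right leibniz_term_def prod.distrib
    by (simp add: ac_simps)
qed

lemma integrable_leibniz_term: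
  assumes "S \<in> sets borel"
  shows "integrable (dA_prod N) (\<lambda>\<zeta>. \<Prod>j<N. leibniz_term S i \<sigma> \<tau> j (\<zeta> j))"
  unfolding dA_prod_def leibniz_term_def using assms
  by (intro dA.product_integrable_prod integrable_moment) auto

text \<open>
  Each unconstrained particle \<open>j \<noteq> i\<close> forces \<open>\<sigma> j = \<tau> j\<close> by orthogonality, and two permutations that agree off one
  point are equal. On the diagonal \<open>\<sigma> = \<tau>\<close> all particles but \<open>i\<close> contribute their norms.
\<close>
lemma integral_leibniz_term:
  assumes S: "S \<in> sets borel" and i: "i < N" and perm: "\<sigma> permutes {..<N}" "\<tau> permutes {..<N}"
  shows "(LINT \<zeta>|dA_prod N. (\<Prod>j<N. leibniz_term S i \<sigma> \<tau> j (\<zeta> j))) =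
    (if \<sigma> = \<tau> then (\<Prod>j<N. of_real (h j)) * (moment S (\<sigma> i) (\<sigma> i) / of_real (h (\<sigma> i))) else 0)"
proof -
  have "(LINT \<zeta>|dA_prod N. (\<Prod>j<N. leibniz_term S i \<sigma> \<tau> j (\<zeta> j))) =
      (\<Prod>j<N. moment (if j = i then S else UNIV) (\<sigma> j) (\<tau> j))"
    unfolding dA_prod_def leibniz_term_def moment_def using S
    by (intro dA.product_integral_prod integrable_moment) auto
  also have "\<dots> = (if \<sigma> = \<tau> then (\<Prod>j<N. of_real (h j)) * (moment S (\<sigma> i) (\<sigma> i) / of_real (h (\<sigma> i))) else 0)"
  proof (cases "\<sigma> = \<tau>")
    case True
    have "(\<Prod>j<N. moment (if j = i then S else UNIV) (\<sigma> j) (\<tau> j)) =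
      (\<Prod>j<N. of_real (h (\<sigma> j)) * (if j = i then moment S (\<sigma> i) (\<sigma> i) / of_real (h (\<sigma> i)) else 1))"
      using True h_pos by (intro prod.cong) (auto simp: moment_UNIV less_imp_neq[OF h_pos, symmetric])
    also have "\<dots> = (\<Prod>j<N. of_real (h (\<sigma> j))) * (moment S (\<sigma> i) (\<sigma> i) / of_real (h (\<sigma> i)))"
      unfolding prod.distrib using i by simp
    also have "(\<Prod>j<N. of_real (h (\<sigma> j)) :: complex) = (\<Prod>j<N. of_real (h j))"
      using prod.permute[OF perm(1), of "\<lambda>j. of_real (h j) :: complex"] by (simp add: o_def)
    finally show ?thesis using True by simp
  next
    case False
    have "\<exists>j<N. j \<noteq> i \<and> \<sigma> j \<noteq> \<tau> j"
    proof (rule ccontr)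
      assume neg: "\<not> ?thesis"
      have eq: "\<sigma> j = \<tau> j" if "j \<noteq> i" for j
        using neg that perm by (cases "j < N") (auto simp: permutes_def)
      have bij: "bij \<sigma>" "bij \<tau>" using perm permutes_bij by blast+
      have "\<sigma> i = \<tau> i"
      proof (rule ccontr)
        assume ne: "\<sigma> i \<noteq> \<tau> i"
        obtain k where k: "\<tau> i = \<sigma> k" using bij(1) by (metis bij_pointE)
        then have "k \<noteq> i" using ne by auto
        then have "\<tau> i = \<tau> k" using k eq by simp
        then show False using bij(2) \<open>k \<noteq> i\<close> by (metis bij_pointE)
      qed
      then have "\<sigma> = \<tau>" using eq by (metis ext)
      then show False using False by simp
    qed
    then obtain j where j: "j < N" "j \<noteq> i" "\<sigma> j \<noteq> \<tau> j" by blast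
    then have "moment (if j = i then S else UNIV) (\<sigma> j) (\<tau> j) = 0" by (simp add: moment_UNIV)
    then show ?thesis using False j by (auto intro!: prod_zero)
  qed
  finally show ?thesis .
qed

lemma
  assumes S: "S \<in> sets borel" and i: "i < N"
  shows integrable_gibbs_weight: "integrable (dA_prod N) (\<lambda>\<zeta>. exp (- energy Q N \<zeta>) * indicator S (\<zeta> i))"
    and integral_gibbs_weight: "of_real (LINT \<zeta>|dA_prod N. exp (- energy Q N \<zeta>) * indicator S (\<zeta> i)) =
      (\<Prod>j<N. of_real (h j)) * (\<Sum>\<sigma> | \<sigma> permutes {..<N}. moment S (\<sigma> i) (\<sigma> i) / of_real (h (\<sigma> i)))"
proof -
  define F where "F \<zeta> = (\<Sum>\<sigma> | \<sigma> permutes {..<N}. \<Sum>\<tau> | \<tau> permutes {..<N}.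
       signof \<sigma> * signof \<tau> * (\<Prod>j<N. leibniz_term S i \<sigma> \<tau> j (\<zeta> j)))" for \<zeta>
  have Em [measurable]: "energy Q N \<in> borel_measurable (dA_prod N)"
    unfolding energy_def[abs_def]
  proof (intro borel_measurable_add borel_measurable_sum borel_measurable_times borel_measurable_const)
    fix j k assume "j \<in> {..<N}" "k \<in> {..<N} - {j}"
    then have [measurable]: "(\<lambda>\<zeta>. \<zeta> j) \<in> borel_measurable (dA_prod N)" "(\<lambda>\<zeta>. \<zeta> k) \<in> borel_measurable (dA_prod N)"
      by (simp_all add: dA_prod_component_measurable)
    show "(\<lambda>\<zeta>. ln (1 / cmod (\<zeta> j - \<zeta> k))) \<in> borel_measurable (dA_prod N)"
      by measurable
  next
    fix j assume "j \<in> {..<N}"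
    then show "(\<lambda>\<zeta>. Q (\<zeta> j)) \<in> borel_measurable (dA_prod N)"
      by (intro measurable_compose[OF dA_prod_component_measurable Q_measurable]) simp
  qed
  note [measurable] = dA_prod_component_measurable[OF i]
  have [measurable]: "S \<in> sets borel" by fact
  have meas: "(\<lambda>\<zeta>. of_real (exp (- energy Q N \<zeta>) * indicator S (\<zeta> i)) :: complex) \<in> borel_measurable (dA_prod N)"
    by measurable
  have intF: "integrable (dA_prod N) F"
    unfolding F_def
    by (intro Bochner_Integration.integrable_sum integrable_mult_right integrable_leibniz_term S)
  have ae: "AE \<zeta> in dA_prod N. F \<zeta> = of_real (exp (- energy Q N \<zeta>) * indicator S (\<zeta> i))"
    using AE_dA_prod_inj[of N] by eventually_elim (simp only: F_def gibbs_weight_expansion[OF _ i])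
  have intC: "integrable (dA_prod N) (\<lambda>\<zeta>. of_real (exp (- energy Q N \<zeta>) * indicator S (\<zeta> i)) :: complex)"
    using integrable_cong_AE_imp[OF intF meas] ae by (auto simp: eq_commute)
  then have "integrable (dA_prod N) (\<lambda>\<zeta>. Re (of_real (exp (- energy Q N \<zeta>) * indicator S (\<zeta> i))))"
    by (rule integrable_Re)
  then show int: "integrable (dA_prod N) (\<lambda>\<zeta>. exp (- energy Q N \<zeta>) * indicator S (\<zeta> i))"
    by (simp only: Re_complex_of_real)
  have "of_real (LINT \<zeta>|dA_prod N. exp (- energy Q N \<zeta>) * indicator S (\<zeta> i)) =
     (LINT \<zeta>|dA_prod N. of_real (exp (- energy Q N \<zeta>) * indicator S (\<zeta> i)) :: complex)"
    by (rule integral_complex_of_real[symmetric])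
  also have "\<dots> = integral\<^sup>L (dA_prod N) F"
    using ae by (intro integral_cong_AE meas borel_measurable_integrable[OF intF]) (auto simp: eq_commute)
  also have "\<dots> = (\<Sum>\<sigma> | \<sigma> permutes {..<N}. \<Sum>\<tau> | \<tau> permutes {..<N}.
       signof \<sigma> * signof \<tau> * (LINT \<zeta>|dA_prod N. (\<Prod>j<N. leibniz_term S i \<sigma> \<tau> j (\<zeta> j))))"
    unfolding F_def
    by (subst Bochner_Integration.integral_sum; (intro Bochner_Integration.integrable_sum integrable_mult_right integrable_leibniz_term S)?)
      (intro sum.cong refl, subst Bochner_Integration.integral_sum;
         (intro integrable_mult_right integrable_leibniz_term S sum.cong refl)?; simp)
  also have "\<dots> = (\<Sum>\<sigma> | \<sigma> permutes {..<N}. \<Sum>\<tau> | \<tau> permutes {..<N}.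
       if \<tau> = \<sigma> then (\<Prod>j<N. of_real (h j)) * (moment S (\<sigma> i) (\<sigma> i) / of_real (h (\<sigma> i))) else 0)"
  proof (intro sum.cong refl)
    fix \<sigma> \<tau> assume p: "\<sigma> \<in> {\<sigma>. \<sigma> permutes {..<N}}" "\<tau> \<in> {\<tau>. \<tau> permutes {..<N}}"
    have "signof \<sigma> * signof \<sigma> = (1 :: complex)"
      by (simp flip: of_int_mult)
    then show "signof \<sigma> * signof \<tau> * (LINT \<zeta>|dA_prod N. (\<Prod>j<N. leibniz_term S i \<sigma> \<tau> j (\<zeta> j))) =
      (if \<tau> = \<sigma> then (\<Prod>j<N. of_real (h j)) * (moment S (\<sigma> i) (\<sigma> i) / of_real (h (\<sigma> i))) else 0)"
      using p by (auto simp: integral_leibniz_term[OF S i])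
  qed
  also have "\<dots> = (\<Sum>\<sigma> | \<sigma> permutes {..<N}. (\<Prod>j<N. of_real (h j)) * (moment S (\<sigma> i) (\<sigma> i) / of_real (h (\<sigma> i))))"
    by (intro sum.cong refl) (simp add: sum.delta finite_permutations)
  finally show "of_real (LINT \<zeta>|dA_prod N. exp (- energy Q N \<zeta>) * indicator S (\<zeta> i)) =
      (\<Prod>j<N. of_real (h j)) * (\<Sum>\<sigma> | \<sigma> permutes {..<N}. moment S (\<sigma> i) (\<sigma> i) / of_real (h (\<sigma> i)))"
    by (simp add: sum_distrib_left)
qed

text \<open>
  Summing over the constrained particle first makes every permutation contribute the same amount, because
  \<open>\<sigma> i\<close> then runs over all of \<open>{..<N}\<close>; hence the factor \<open>N!\<close>.
\<close>
lemma sum_integral_gibbs_weight: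
  assumes S: "S \<in> sets borel"
  shows "of_real (\<Sum>i<N. LINT \<zeta>|dA_prod N. exp (- energy Q N \<zeta>) * indicator S (\<zeta> i)) =
      (\<Prod>j<N. of_real (h j)) * (fact N * (\<Sum>m<N. moment S m m / of_real (h m)))"
proof -
  have "of_real (\<Sum>i<N. LINT \<zeta>|dA_prod N. exp (- energy Q N \<zeta>) * indicator S (\<zeta> i)) =
     (\<Prod>j<N. of_real (h j)) * (\<Sum>i<N. \<Sum>\<sigma> | \<sigma> permutes {..<N}. moment S (\<sigma> i) (\<sigma> i) / of_real (h (\<sigma> i)))"
  proof -
    have "of_real (\<Sum>i<N. LINT \<zeta>|dA_prod N. exp (- energy Q N \<zeta>) * indicator S (\<zeta> i)) =
      (\<Sum>i<N. (\<Prod>j<N. of_real (h j)) * (\<Sum>\<sigma> | \<sigma> permutes {..<N}. moment S (\<sigma> i) (\<sigma> i) / of_real (h (\<sigma> i))))"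
      unfolding of_real_sum by (intro sum.cong refl) (simp only: integral_gibbs_weight[OF S] lessThan_iff)
    then show ?thesis by (simp only: sum_distrib_left[symmetric])
  qed
  also have "(\<Sum>i<N. \<Sum>\<sigma> | \<sigma> permutes {..<N}. moment S (\<sigma> i) (\<sigma> i) / of_real (h (\<sigma> i))) =
     (\<Sum>\<sigma> | \<sigma> permutes {..<N}. \<Sum>i<N. moment S (\<sigma> i) (\<sigma> i) / of_real (h (\<sigma> i)))"
    by (rule sum.swap)
  also have "\<dots> = (\<Sum>\<sigma> | \<sigma> permutes {..<N}. \<Sum>m<N. moment S m m / of_real (h m))"
  proof (rule sum.cong[OF refl])
    fix \<sigma> assume "\<sigma> \<in> {\<sigma>. \<sigma> permutes {..<N}}"
    then have "\<sigma> permutes {..<N}" by simp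
    from sum.permute[OF this, of "\<lambda>m. moment S m m / of_real (h m)"]
    show "(\<Sum>i<N. moment S (\<sigma> i) (\<sigma> i) / of_real (h (\<sigma> i))) = (\<Sum>m<N. moment S m m / of_real (h m))"
      by (simp add: o_def)
  qed
  also have "\<dots> = fact N * (\<Sum>m<N. moment S m m / of_real (h m))"
    by (simp add: card_permutations[where n = N])
  finally show ?thesis .
qed

text \<open>
  The case of the trivial test set: the sum over particles consists of \<open>N\<close> copies of the partition function.
\<close>
lemma partition_function_eq: "partition_function Q N = fact N * (\<Prod>j<N. h j)"
proof -
  have "complex_of_real (real N * partition_function Q N) = of_real (\<Sum>i<N. LINT \<zeta>|dA_prod N. exp (- energy Q N \<zeta>) * indicator UNIV (\<zeta> i))"
    by (simp add: partition_function_def)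
  also have "\<dots> = (\<Prod>j<N. of_real (h j)) * (fact N * (\<Sum>m<N. moment UNIV m m / of_real (h m)))"
    by (rule sum_integral_gibbs_weight) simp
  also have "(\<Sum>m<N. moment UNIV m m / of_real (h m)) = of_nat N"
    using h_pos by (simp add: moment_UNIV less_imp_neq[OF h_pos, symmetric])
  finally have "complex_of_real (real N * partition_function Q N) = of_real (real N * (fact N * (\<Prod>j<N. h j)))"
    by (simp add: ac_simps)
  then have "real N * partition_function Q N = real N * (fact N * (\<Prod>j<N. h j))"
    by (simp only: of_real_eq_iff)
  then show ?thesis using N_pos by simp
qed

definition particle_density :: "complex \<Rightarrow> real" where
  "particle_density z = (\<Sum>m<N. (cmod (poly (P m) z))\<^sup>2 * weight z / h m)"

lemma integrable_particle_density_summand: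
  assumes "S \<in> sets borel"
  shows "integrable dA (\<lambda>z. (cmod (poly (P m) z))\<^sup>2 * weight z * indicator S z)"
    and "moment S m m = of_real (LINT z|dA. (cmod (poly (P m) z))\<^sup>2 * weight z * indicator S z)"
proof -
  have e: "poly (P m) z * cnj (poly (P m) z) * of_real (weight z) * of_real (indicator S z) =
     of_real ((cmod (poly (P m) z))\<^sup>2 * weight z * indicator S z)" for z
    by (simp only: complex_norm_square of_real_mult)
  from integrable_moment[OF assms, of m m]
  have "integrable dA (\<lambda>z. Re (of_real ((cmod (poly (P m) z))\<^sup>2 * weight z * indicator S z)))"
    unfolding e by (rule integrable_Re)
  then show "integrable dA (\<lambda>z. (cmod (poly (P m) z))\<^sup>2 * weight z * indicator S z)"
    by (simp only: Re_complex_of_real)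
  show "moment S m m = of_real (LINT z|dA. (cmod (poly (P m) z))\<^sup>2 * weight z * indicator S z)"
    unfolding moment_def e by (rule integral_complex_of_real)
qed

lemma integrable_particle_density: "S \<in> sets borel \<Longrightarrow> integrable dA (\<lambda>z. particle_density z * indicator S z)"
  and integral_particle_density: "S \<in> sets borel \<Longrightarrow> (LINT z|dA. particle_density z * indicator S z) =
    (\<Sum>m<N. (LINT z|dA. (cmod (poly (P m) z))\<^sup>2 * weight z * indicator S z) / h m)"
proof -
  assume S: "S \<in> sets borel"
  have e: "particle_density z * indicator S z = (\<Sum>m<N. (cmod (poly (P m) z))\<^sup>2 * weight z * indicator S z / h m)" for z
    unfolding particle_density_def sum_distrib_right by simp
  show "integrable dA (\<lambda>z. particle_density z * indicator S z)"
    unfolding e by (intro Bochner_Integration.integrable_sum integrable_divide integrable_particle_density_summand S)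
  show "(LINT z|dA. particle_density z * indicator S z) =
    (\<Sum>m<N. (LINT z|dA. (cmod (poly (P m) z))\<^sup>2 * weight z * indicator S z) / h m)"
    unfolding e
    by (subst Bochner_Integration.integral_sum; (intro integrable_divide integrable_particle_density_summand S)?)
      simp
qed

text \<open>
  The normalization \<open>N! \<Prod> h\<close> cancels against the partition function and leaves the diagonal of the
  reproducing kernel.
\<close>
theorem expected_number_of_particles:
  assumes S: "S \<in> sets borel"
  shows "(LINT \<zeta>|gibbs_measure Q N. real (card {j. j < N \<and> \<zeta> j \<in> S})) = (LINT z|dA. particle_density z * indicator S z)"
proof -
  define Z where "Z = partition_function Q N"
  have Z: "Z > 0" unfolding Z_def partition_function_eq using h_pos by (simp add: prod_pos)
  have card: "real (card {j. j < N \<and> \<zeta> j \<in> S}) = (\<Sum>j<N. indicator S (\<zeta> j))" for \<zeta> :: "nat \<Rightarrow> complex"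
  proof -
    have "{j. j < N \<and> \<zeta> j \<in> S} = {..<N} \<inter> {j. \<zeta> j \<in> S}" by auto
    then show ?thesis by (simp add: indicator_def sum_of_bool_eq)
  qed
  have [measurable]: "S \<in> sets borel" by fact
  have Em: "(\<lambda>\<zeta>. exp (- energy Q N \<zeta>)) \<in> borel_measurable (dA_prod N)"
    using borel_measurable_integrable[OF integrable_gibbs_weight[of UNIV 0]] N_pos by simp
  have cm: "(\<lambda>\<zeta>. \<Sum>j<N. indicator S (\<zeta> j) :: real) \<in> borel_measurable (dA_prod N)"
    by (intro borel_measurable_sum measurable_compose[OF dA_prod_component_measurable]) auto
  have "(LINT \<zeta>|gibbs_measure Q N. real (card {j. j < N \<and> \<zeta> j \<in> S})) =
     (LINT \<zeta>|dA_prod N. (exp (- energy Q N \<zeta>) / Z) * (\<Sum>j<N. indicator S (\<zeta> j)))"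
    unfolding gibbs_measure_def card Z_def[symmetric]
    using Z Em cm by (subst integral_density) auto
  also have "\<dots> = (LINT \<zeta>|dA_prod N. (\<Sum>j<N. exp (- energy Q N \<zeta>) * indicator S (\<zeta> j)) / Z)"
    by (intro Bochner_Integration.integral_cong refl) (simp only: times_divide_eq_left sum_distrib_left[symmetric])
  also have "\<dots> = (\<Sum>j<N. LINT \<zeta>|dA_prod N. exp (- energy Q N \<zeta>) * indicator S (\<zeta> j)) / Z"
    by (subst integral_divide_zero, subst Bochner_Integration.integral_sum)
      (use integrable_gibbs_weight[OF S] in auto)
  also have "(\<Sum>j<N. LINT \<zeta>|dA_prod N. exp (- energy Q N \<zeta>) * indicator S (\<zeta> j)) =
     Z * (LINT z|dA. particle_density z * indicator S z)"
  proof -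
    have "complex_of_real (\<Sum>j<N. LINT \<zeta>|dA_prod N. exp (- energy Q N \<zeta>) * indicator S (\<zeta> j)) =
       of_real ((\<Prod>j<N. h j) * (fact N * (\<Sum>m<N. (LINT z|dA. (cmod (poly (P m) z))\<^sup>2 * weight z * indicator S z) / h m)))"
      unfolding sum_integral_gibbs_weight[OF S] integrable_particle_density_summand(2)[OF S] by simp
    then show ?thesis
      unfolding of_real_eq_iff integral_particle_density[OF S] Z_def partition_function_eq by simp
  qed
  finally show ?thesis using Z by simp
qed

lemma measure_dA_ball: "r \<ge> 0 \<Longrightarrow> measure dA (ball z r) = r\<^sup>2"
proof -
  assume r: "r \<ge> 0"
  have m: "indicat_real (ball z r) \<in> borel_measurable borel"
    by (intro borel_measurable_indicator borel_open open_ball)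
  have "measure dA (ball z r) = (LINT w|dA. indicator (ball z r) w)" by simp
  also have "\<dots> = (1 / pi) * (LINT w|lborel. indicator (ball z r) w)"
    using integral_dA(1)[OF m] by simp
  also have "(LINT w|lborel. indicator (ball z r) w) = pi * r\<^sup>2"
    using r by (simp add: content_ball unit_ball_vol_2)
  finally show ?thesis by simp
qed

text \<open>
  The disc of radius \<open>\<epsilon>\<close> has normalized area \<open>\<epsilon>\<^sup>2\<close>, so the quotient in the definition is an average of a
  continuous function over a shrinking disc.
\<close>
theorem one_point_function_eq_density:
  assumes cont: "continuous_on UNIV Q"
  shows "one_point_function Q N z = particle_density z"
proof -
  have cont_density: "isCont particle_density z"
  proof -
    have "continuous_on UNIV particle_density"
      unfolding particle_density_def weight_def divide_inverse by (intro continuous_intros cont)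
    then show ?thesis by (simp add: continuous_on_eq_continuous_at)
  qed
  have fin: "emeasure dA (ball z r) < \<infinity>" for r
  proof -
    have "emeasure dA (ball z r) = ennreal (1 / pi) * emeasure lborel (ball z r)"
      unfolding dA_def by (subst emeasure_density_const) auto
    also have "\<dots> < \<infinity>"
      using emeasure_bounded_finite[of "ball z r"] by (simp add: ennreal_mult_less_top)
    finally show ?thesis .
  qed
  have "((\<lambda>\<epsilon>. (LINT w|dA. particle_density w * indicator (ball z \<epsilon>) w) / \<epsilon>\<^sup>2) \<longlongrightarrow> particle_density z) (at_right 0)"
  proof (rule tendstoI)
    fix e :: real assume e: "e > 0"
    obtain d where d: "d > 0" "\<And>w. dist w z < d \<Longrightarrow> dist (particle_density w) (particle_density z) < e / 2"
      using cont_density e unfolding continuous_at_eps_delta dist_norm by (metis half_gt_zero norm_minus_commute)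
    show "\<forall>\<^sub>F \<epsilon> in at_right 0. dist ((LINT w|dA. particle_density w * indicator (ball z \<epsilon>) w) / \<epsilon>\<^sup>2) (particle_density z) < e"
      unfolding eventually_at_right_field
    proof (intro exI conjI allI impI)
      show "0 < d" by fact
      fix \<epsilon> :: real assume eps: "0 < \<epsilon>" "\<epsilon> < d"
      define B where "B = ball z \<epsilon>"
      have B: "B \<in> sets borel" "emeasure dA B < \<infinity>" unfolding B_def using fin by auto
      have i1: "integrable dA (\<lambda>w. particle_density w * indicator B w)" by (rule integrable_particle_density[OF B(1)])
      have i2: "integrable dA (\<lambda>w. c * indicator B w)" for c :: real
        using B by (intro integrable_mult_right integrable_real_indicator) auto
      have ib: "(LINT w|dA. c * indicator B w) = c * \<epsilon>\<^sup>2" for c :: real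
        using eps by (simp add: B_def measure_dA_ball)
      have "\<bar>(LINT w|dA. particle_density w * indicator B w) - particle_density z * \<epsilon>\<^sup>2\<bar> =
         \<bar>LINT w|dA. particle_density w * indicator B w - particle_density z * indicator B w\<bar>"
        using i1 i2 by (simp add: ib[symmetric])
      also have "\<dots> \<le> (LINT w|dA. \<bar>particle_density w * indicator B w - particle_density z * indicator B w\<bar>)"
        by (rule integral_abs_bound)
      also have "\<dots> \<le> (LINT w|dA. (e / 2) * indicator B w)"
      proof (rule integral_mono)
        show "integrable dA (\<lambda>w. \<bar>particle_density w * indicator B w - particle_density z * indicator B w\<bar>)"
          using i1 i2 by (intro integrable_abs Bochner_Integration.integrable_diff)
        show "integrable dA (\<lambda>w. (e / 2) * indicator B w)" by (rule i2)
        fix w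
        show "\<bar>particle_density w * indicator B w - particle_density z * indicator B w\<bar> \<le> (e / 2) * indicator B w"
          using d(2)[of w] eps by (cases "w \<in> B") (auto simp: B_def dist_commute dist_real_def less_imp_le)
      qed
      also have "\<dots> = (e / 2) * \<epsilon>\<^sup>2" by (rule ib)
      finally have "\<bar>(LINT w|dA. particle_density w * indicator B w) - particle_density z * \<epsilon>\<^sup>2\<bar> / \<epsilon>\<^sup>2 \<le> e / 2"
        using eps by (simp add: divide_le_eq)
      then have "\<bar>(LINT w|dA. particle_density w * indicator B w) / \<epsilon>\<^sup>2 - particle_density z\<bar> \<le> e / 2"
      proof -
        have "(LINT w|dA. particle_density w * indicator B w) / \<epsilon>\<^sup>2 - particle_density z =
            ((LINT w|dA. particle_density w * indicator B w) - particle_density z * \<epsilon>\<^sup>2) / \<epsilon>\<^sup>2"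
          using eps by (simp add: diff_divide_distrib)
        moreover assume "\<bar>(LINT w|dA. particle_density w * indicator B w) - particle_density z * \<epsilon>\<^sup>2\<bar> / \<epsilon>\<^sup>2 \<le> e / 2"
        ultimately show ?thesis by (simp add: abs_divide)
      qed
      then show "dist ((LINT w|dA. particle_density w * indicator (ball z \<epsilon>) w) / \<epsilon>\<^sup>2) (particle_density z) < e"
        using e by (simp add: dist_real_def B_def)
    qed
  qed
  then have "((\<lambda>\<epsilon>. (LINT \<zeta>|gibbs_measure Q N. real (card {j. j < N \<and> \<zeta> j \<in> ball z \<epsilon>})) / \<epsilon>\<^sup>2) \<longlongrightarrow> particle_density z) (at_right 0)"
    by (simp only: expected_number_of_particles open_ball borel_open)
  then show ?thesis
    unfolding one_point_function_def by (intro tendsto_Lim) simp_all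
qed

end

section \<open>The semicircle law for the Hermite kernel\<close>

text \<open>
  The squared normalized Hermite function, up to the factor \<open>sqrt (2 pi v)\<close>.
\<close>
definition hermite_density :: "real \<Rightarrow> nat \<Rightarrow> real \<Rightarrow> real" where
  "hermite_density v k x = (hermite v k x)\<^sup>2 / (fact k * v ^ k) * gauss_weight v x"

definition hermite_kernel :: "real \<Rightarrow> nat \<Rightarrow> real \<Rightarrow> real" where
  "hermite_kernel v n x = (\<Sum>k<n. hermite_density v k x)"

lemma hermite_density_nonneg: "v > 0 \<Longrightarrow> hermite_density v k x \<ge> 0"
  by (simp add: hermite_density_def less_imp_le)

lemma hermite_kernel_mono: "v > 0 \<Longrightarrow> m \<le> n \<Longrightarrow> hermite_kernel v m x \<le> hermite_kernel v n x"
  unfolding hermite_kernel_def by (intro sum_mono2) (auto simp: hermite_density_nonneg)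

lemma hermite_kernel_pos:
  assumes "v > 0" "n > 0"
  shows "hermite_kernel v n x > 0"
proof -
  have "0 < hermite_kernel v 1 x" by (simp add: hermite_kernel_def hermite_density_def)
  also have "\<dots> \<le> hermite_kernel v n x" using assms by (intro hermite_kernel_mono) auto
  finally show ?thesis .
qed

text \<open>
  The confluent Christoffel-Darboux formula; the recurrence has eliminated the derivatives and \<open>H\<^sub>n\<^sub>-\<^sub>1\<close>.
\<close>
lemma hermite_christoffel_darboux:
  fixes v :: real
  assumes "v \<noteq> 0"
  shows "fact n * v ^ Suc n * (\<Sum>k<Suc n. (hermite v k x)\<^sup>2 / (fact k * v ^ k)) =
     (hermite v (Suc n) x)\<^sup>2 - x * hermite v n x * hermite v (Suc n) x + v * real (Suc n) * (hermite v n x)\<^sup>2"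
proof (induction n)
  case 0
  then show ?case by (simp add: power2_eq_square)
next
  case (Suc n)
  define a where "a = hermite v n x"
  define b where "b = hermite v (Suc n) x"
  define S where "S = (\<Sum>k<Suc n. (hermite v k x)\<^sup>2 / (fact k * v ^ k))"
  have IH: "fact n * v ^ Suc n * S = b\<^sup>2 - x * a * b + v * real (Suc n) * a\<^sup>2"
    using Suc.IH unfolding a_def b_def S_def .
  have "fact (Suc n) * v ^ Suc (Suc n) * (\<Sum>k<Suc (Suc n). (hermite v k x)\<^sup>2 / (fact k * v ^ k)) =
      fact (Suc n) * v ^ Suc (Suc n) * (S + b\<^sup>2 / (fact (Suc n) * v ^ Suc n))"
    unfolding S_def b_def by simp
  also have "\<dots> = v * real (Suc n) * (fact n * v ^ Suc n * S)
      + fact (Suc n) * v ^ Suc (Suc n) * (b\<^sup>2 / (fact (Suc n) * v ^ Suc n))"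
    by (simp add: algebra_simps)
  also have "\<dots> = v * real (Suc n) * (b\<^sup>2 - x * a * b + v * real (Suc n) * a\<^sup>2) + v * b\<^sup>2"
    unfolding IH using assms by (simp del: fact_Suc)
  also have "\<dots> = (x * b - v * real (Suc n) * a)\<^sup>2 - x * b * (x * b - v * real (Suc n) * a) + v * real (Suc (Suc n)) * b\<^sup>2"
    by (simp add: power2_eq_square algebra_simps)
  also have "x * b - v * real (Suc n) * a = hermite v (Suc (Suc n)) x"
    by (simp add: a_def b_def)
  finally show ?case unfolding b_def .
qed

text \<open>
  The weight is \<open>exp (- x\<^sup>2 / (4v))\<close>, the square root of the Gaussian of variance \<open>v\<close>, so that a harmonic oscillator equation
  without first-order term holds.
\<close>
definition hermite_function :: "real \<Rightarrow> nat \<Rightarrow> real \<Rightarrow> real" where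
  "hermite_function v n x = hermite v n x * gauss_weight (2 * v) x"

definition hermite_function' :: "real \<Rightarrow> nat \<Rightarrow> real \<Rightarrow> real" where
  "hermite_function' v n x = (real n * hermite v (n - 1) x - x / (2 * v) * hermite v n x) * gauss_weight (2 * v) x"

lemma gauss_weight_double: "(gauss_weight (2 * v) x)\<^sup>2 = gauss_weight v x"
  unfolding gauss_weight_def power2_eq_square[of "exp _"] exp_add[symmetric] by (simp add: field_simps)

lemma hermite_function_deriv:
  assumes "v \<noteq> 0"
  shows "(hermite_function v n has_field_derivative hermite_function' v n x) (at x)"
proof -
  have "((\<lambda>x. hermite v n x * gauss_weight (2 * v) x) has_field_derivative
     of_nat n * hermite v (n - 1) x * gauss_weight (2 * v) x + - (x / (2 * v)) * gauss_weight (2 * v) x * hermite v n x) (at x)"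
    using assms by (intro DERIV_mult hermite_deriv gauss_weight_deriv) auto
  then show ?thesis
    unfolding hermite_function_def[abs_def] hermite_function'_def by (simp add: algebra_simps)
qed

lemma hermite_function_ode:
  assumes "v \<noteq> 0"
  shows "(hermite_function' v n has_field_derivative
     - ((real n + 1 / 2 - x\<^sup>2 / (4 * v)) / v) * hermite_function v n x) (at x)"
proof -
  have "((\<lambda>x. (real n * hermite v (n - 1) x - x / (2 * v) * hermite v n x) * gauss_weight (2 * v) x) has_field_derivative
     (real n * (of_nat (n - 1) * hermite v (n - 1 - 1) x) -
        (1 / (2 * v) * hermite v n x + of_nat n * hermite v (n - 1) x * (x / (2 * v)))) * gauss_weight (2 * v) x
      + - (x / (2 * v)) * gauss_weight (2 * v) x * (real n * hermite v (n - 1) x - x / (2 * v) * hermite v n x)) (at x)"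
    using assms by (intro DERIV_mult DERIV_diff DERIV_cmult hermite_deriv gauss_weight_deriv DERIV_cdivide DERIV_ident) auto
  also have "real n * (of_nat (n - 1) * hermite v (n - 1 - 1) x) = real n * (x * hermite v (n - 1) x - hermite v n x) / v"
  proof (cases n)
    case (Suc m)
    have "v * (of_nat m * hermite v (m - 1) x) = x * hermite v m x - hermite v (Suc m) x"
      unfolding hermite_rec by simp
    then have "of_nat m * hermite v (m - 1) x = (x * hermite v m x - hermite v (Suc m) x) / v"
      using assms by (simp add: field_simps)
    then show ?thesis using Suc by simp
  qed simp
  also have "(real n * (x * hermite v (n - 1) x - hermite v n x) / v -
        (1 / (2 * v) * hermite v n x + of_nat n * hermite v (n - 1) x * (x / (2 * v)))) * gauss_weight (2 * v) x
      + - (x / (2 * v)) * gauss_weight (2 * v) x * (real n * hermite v (n - 1) x - x / (2 * v) * hermite v n x)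
     = - ((real n + 1 / 2 - x\<^sup>2 / (4 * v)) / v) * (hermite v n x * gauss_weight (2 * v) x)"
    using assms by (simp add: field_simps power2_eq_square)
  finally show ?thesis
    unfolding hermite_function_def hermite_function'_def[abs_def] .
qed

text \<open>
  The Christoffel-Darboux expression is a quadratic form in \<open>H\<^sub>n\<close> and \<open>H\<^sub>n\<^sub>-\<^sub>1\<close>; in terms of the Hermite function and its
  derivative it becomes diagonal and looks like an oscillator energy.
\<close>
lemma hermite_kernel_energy:
  assumes "v \<noteq> 0"
  shows "fact n * v ^ n * hermite_kernel v n x =
    v * (hermite_function' v n x)\<^sup>2 + (real n - x\<^sup>2 / (4 * v)) * (hermite_function v n x)\<^sup>2"
proof (cases n)
  case 0
  then show ?thesis using assms
    by (simp add: hermite_kernel_def hermite_function_def hermite_function'_def field_simps power2_eq_square)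
next
  case (Suc m)
  define a where "a = hermite v m x"
  define b where "b = hermite v n x"
  define g where "g = gauss_weight (2 * v) x"
  define S where "S = (\<Sum>k<Suc m. (hermite v k x)\<^sup>2 / (fact k * v ^ k))"
  have "hermite_kernel v n x = S * gauss_weight v x"
    unfolding hermite_kernel_def hermite_density_def S_def Suc sum_distrib_right ..
  then have "fact n * v ^ n * hermite_kernel v n x = real n * (fact m * v ^ Suc m * S) * g\<^sup>2"
    unfolding g_def gauss_weight_double Suc by simp
  also have "fact m * v ^ Suc m * S = b\<^sup>2 - x * a * b + v * real n * a\<^sup>2"
    unfolding S_def hermite_christoffel_darboux[OF assms] a_def b_def Suc ..
  also have "real n * (b\<^sup>2 - x * a * b + v * real n * a\<^sup>2) * g\<^sup>2 =
     v * ((real n * a - x / (2 * v) * b) * g)\<^sup>2 + (real n - x\<^sup>2 / (4 * v)) * (b * g)\<^sup>2"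
    using assms by (simp add: field_simps power2_eq_square)
  finally show ?thesis
    unfolding hermite_function_def hermite_function'_def a_def b_def g_def Suc by simp
qed

text \<open>
  Dropping the kinetic term of the energy. In the bulk it says that a single level carries only a
  fraction \<open>O(1/n)\<close> of the kernel.
\<close>
lemma hermite_density_le_kernel:
  assumes "v > 0"
  shows "(real n - x\<^sup>2 / (4 * v)) * hermite_density v n x \<le> hermite_kernel v n x"
proof -
  have d: "fact n * v ^ n * hermite_density v n x = (hermite_function v n x)\<^sup>2"
    using assms unfolding hermite_density_def hermite_function_def power_mult_distrib gauss_weight_double by simp
  have "fact n * v ^ n * ((real n - x\<^sup>2 / (4 * v)) * hermite_density v n x) =
      (real n - x\<^sup>2 / (4 * v)) * (hermite_function v n x)\<^sup>2"
    unfolding d[symmetric] by simp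
  also have "\<dots> \<le> fact n * v ^ n * hermite_kernel v n x"
    using assms by (subst hermite_kernel_energy) auto
  finally show ?thesis using assms by simp
qed

text \<open>
  Cauchy's inequality between the kinetic and the potential part of the energy.
\<close>
lemma product_le_energy:
  fixes a b q :: real
  assumes "q > 0" "b\<^sup>2 + q * a\<^sup>2 > 0"
  shows "\<bar>a * b / (b\<^sup>2 + q * a\<^sup>2)\<bar> \<le> 1 / (2 * sqrt q)"
proof -
  have "0 \<le> (\<bar>b\<bar> - sqrt q * \<bar>a\<bar>)\<^sup>2" by simp
  also have "\<dots> = (b\<^sup>2 + q * a\<^sup>2) - 2 * sqrt q * \<bar>a * b\<bar>"
    using assms by (simp add: power2_diff power_mult_distrib abs_mult)
  finally have "2 * sqrt q * \<bar>a * b\<bar> \<le> b\<^sup>2 + q * a\<^sup>2" by simp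
  moreover have "\<bar>a * b / (b\<^sup>2 + q * a\<^sup>2)\<bar> = \<bar>a * b\<bar> / (b\<^sup>2 + q * a\<^sup>2)"
    using assms(2) by (simp only: abs_divide abs_of_pos)
  ultimately show ?thesis using assms
    by (simp add: divide_le_eq le_divide_eq mult.commute)
qed

text \<open>
  Along solutions of \<open>f'' = - Q f\<close> the energy satisfies \<open>G' = Q' f\<^sup>2\<close>. On average potential and kinetic energy
  are equal, \<open>Q f\<^sup>2 = G/2 - (f f')'/2\<close>, so the derivative of \<open>ln G - (ln Q)/2\<close> is \<open>- (Q' / (2Q)) (f f')' / G\<close>, to
  leading order a total derivative. Adding \<open>(Q' / (2Q)) (f f' / G)\<close> absorbs that term, and the derivative of the corrected quantity \<open>L\<close> contains
  only second-order quantities \<open>Q''\<close> and \<open>Q'\<^sup>2\<close>, damped by the bound on \<open>f f' / G\<close>.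
\<close>
lemma adiabatic_invariant:
  fixes f f' Q Q' Q'' :: "real \<Rightarrow> real"
  defines "G \<equiv> \<lambda>x. (f' x)\<^sup>2 + Q x * (f x)\<^sup>2"
  defines "L \<equiv> \<lambda>x. ln (G x) - ln (Q x) / 2 + Q' x / (2 * Q x) * (f x * f' x / G x)"
  assumes S: "convex S" "a \<in> S" "b \<in> S"
    and f: "\<And>x. x \<in> S \<Longrightarrow> (f has_field_derivative f' x) (at x)"
    and f': "\<And>x. x \<in> S \<Longrightarrow> (f' has_field_derivative - Q x * f x) (at x)"
    and Q: "\<And>x. x \<in> S \<Longrightarrow> (Q has_field_derivative Q' x) (at x)"
    and Q': "\<And>x. x \<in> S \<Longrightarrow> (Q' has_field_derivative Q'' x) (at x)"
    and Qpos: "\<And>x. x \<in> S \<Longrightarrow> Q x > 0"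
    and Gpos: "\<And>x. x \<in> S \<Longrightarrow> G x > 0"
    and M: "\<And>x. x \<in> S \<Longrightarrow> (\<bar>Q'' x\<bar> / (2 * Q x) + (Q' x)\<^sup>2 / (Q x)\<^sup>2) / (2 * sqrt (Q x)) \<le> M"
  shows "\<bar>L a - L b\<bar> \<le> M * \<bar>a - b\<bar>"
proof -
  \<comment> \<open>What remains of the derivative of the corrected logarithm after the first-order terms cancel.\<close>
  define r where "r x = f x * f' x / G x" for x
  define L' where "L' x = (Q'' x / (2 * Q x) - (Q' x)\<^sup>2 / (2 * (Q x)\<^sup>2)) * r x - (Q' x)\<^sup>2 / (2 * Q x) * r x * ((f x)\<^sup>2 / G x)" for x
  have "(L has_field_derivative L' x) (at x within S)" if x: "x \<in> S" for x
  proof -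
    note der = f[OF x] f'[OF x] Q[OF x] Q'[OF x]
    have nz: "Q x \<noteq> 0" "G x \<noteq> 0" using Qpos[OF x] Gpos[OF x] by auto
    have dG: "(G has_field_derivative Q' x * (f x)\<^sup>2) (at x)"
      unfolding G_def by (rule derivative_eq_intros der refl)+ (simp add: algebra_simps power2_eq_square)
    have dr: "(r has_field_derivative (G x - 2 * Q x * (f x)\<^sup>2) / G x - r x * (Q' x * (f x)\<^sup>2) / G x) (at x)"
      unfolding r_def using nz
      by (auto intro!: derivative_eq_intros der dG simp: G_def power2_eq_square divide_simps)
    have "(L has_field_derivative Q' x * (f x)\<^sup>2 / G x - Q' x / Q x / 2
        + ((Q'' x * (2 * Q x) - Q' x * (2 * Q' x)) / (2 * Q x * (2 * Q x)) * r x
         + ((G x - 2 * Q x * (f x)\<^sup>2) / G x - r x * (Q' x * (f x)\<^sup>2) / G x) * (Q' x / (2 * Q x)))) (at x)"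
      unfolding L_def r_def[symmetric] using nz Qpos[OF x] Gpos[OF x]
      by (intro DERIV_add DERIV_diff DERIV_mult DERIV_divide DERIV_cmult dr der DERIV_cdivide)
        (auto intro!: derivative_eq_intros dG der simp: field_simps)
    also have "Q' x * (f x)\<^sup>2 / G x - Q' x / Q x / 2
        + ((Q'' x * (2 * Q x) - Q' x * (2 * Q' x)) / (2 * Q x * (2 * Q x)) * r x
         + ((G x - 2 * Q x * (f x)\<^sup>2) / G x - r x * (Q' x * (f x)\<^sup>2) / G x) * (Q' x / (2 * Q x))) = L' x"
      unfolding L'_def using nz by (simp add: field_simps power2_eq_square)
    finally show ?thesis by (rule has_field_derivative_at_within)
  qed
  moreover have "norm (L' x) \<le> M" if x: "x \<in> S" for x
  proof -
    have pos: "Q x > 0" "G x > 0" "sqrt (Q x) > 0" using Qpos[OF x] Gpos[OF x] by auto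
    have r: "\<bar>r x\<bar> \<le> 1 / (2 * sqrt (Q x))"
      using product_le_energy[of "Q x" "f' x" "f x"] pos by (simp add: r_def G_def)
    have q: "(f x)\<^sup>2 / G x \<le> 1 / Q x"
      using pos by (simp add: G_def field_simps)
    have q0: "(f x)\<^sup>2 / G x \<ge> 0" using pos by simp
    have "\<bar>L' x\<bar> \<le> \<bar>(Q'' x / (2 * Q x) - (Q' x)\<^sup>2 / (2 * (Q x)\<^sup>2)) * r x\<bar> + \<bar>(Q' x)\<^sup>2 / (2 * Q x) * r x * ((f x)\<^sup>2 / G x)\<bar>"
      unfolding L'_def by (rule abs_triangle_ineq4)
    also have "\<dots> = \<bar>Q'' x / (2 * Q x) - (Q' x)\<^sup>2 / (2 * (Q x)\<^sup>2)\<bar> * \<bar>r x\<bar> + (Q' x)\<^sup>2 / (2 * Q x) * \<bar>r x\<bar> * ((f x)\<^sup>2 / G x)"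
      using pos q0 by (simp add: abs_mult)
    also have "\<dots> \<le> (\<bar>Q'' x / (2 * Q x)\<bar> + \<bar>(Q' x)\<^sup>2 / (2 * (Q x)\<^sup>2)\<bar>) * (1 / (2 * sqrt (Q x))) + (Q' x)\<^sup>2 / (2 * Q x) * (1 / (2 * sqrt (Q x))) * (1 / Q x)"
      using pos q q0 r by (intro add_mono mult_mono abs_triangle_ineq4) auto
    also have "\<dots> = (\<bar>Q'' x\<bar> / (2 * Q x) + (Q' x)\<^sup>2 / (Q x)\<^sup>2) / (2 * sqrt (Q x))"
      using pos by (simp add: divide_simps power2_eq_square) 
    also have "\<dots> \<le> M" by (rule M[OF x])
    finally show ?thesis by simp
  qed
  ultimately have "norm (L a - L b) \<le> M * norm (a - b)"
    using S by (intro field_differentiable_bound[of S L L' M]) auto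
  then show ?thesis by simp
qed

text \<open>
  This is \<open>(2m choose m) / 4\<^sup>m\<close>.
\<close>
definition wallis_ratio :: "nat \<Rightarrow> real" where
  "wallis_ratio m = (\<Prod>k=1..m. (2 * real k - 1) / (2 * real k))"

lemma wallis_ratio_nonneg: "wallis_ratio m \<ge> 0"
  unfolding wallis_ratio_def by (intro prod_nonneg) auto

text \<open>
  The square of the sequence is the inverse of Wallis's partial product.
\<close>
lemma wallis_ratio_limit: "(\<lambda>m. wallis_ratio m * sqrt (2 * real m + 1)) \<longlonglongrightarrow> sqrt (2 / pi)"
proof -
  have "(wallis_ratio m)\<^sup>2 * (2 * real m + 1) = inverse (\<Prod>k=1..m. (4 * (real k)\<^sup>2) / (4 * (real k)\<^sup>2 - 1))" for m
  proof (induction m)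
    case 0
    then show ?case by (simp add: wallis_ratio_def)
  next
    case (Suc m)
    have nz: "(4 * (real (Suc m))\<^sup>2 - 1) = (2 * real m + 1) * (2 * real m + 3)"
      by (simp add: power2_eq_square algebra_simps)
    have step: "wallis_ratio (Suc m) = wallis_ratio m * ((2 * real m + 1) / (2 * (real m + 1)))"
      by (simp add: wallis_ratio_def algebra_simps)
    have "(wallis_ratio (Suc m))\<^sup>2 * (2 * real (Suc m) + 1) =
       ((wallis_ratio m)\<^sup>2 * (2 * real m + 1)) * ((2 * real m + 1) * (2 * real m + 3) / (4 * (real (Suc m))\<^sup>2))"
      unfolding step by (simp add: power_mult_distrib power_divide power2_eq_square algebra_simps)
    also have "\<dots> = inverse (\<Prod>k=1..Suc m. (4 * (real k)\<^sup>2) / (4 * (real k)\<^sup>2 - 1))"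
    proof -
      have X: "(2 * real m + 1) * (2 * real m + 3) / (4 * (real (Suc m))\<^sup>2) =
          inverse ((4 * (real (Suc m))\<^sup>2) / (4 * (real (Suc m))\<^sup>2 - 1))"
        unfolding nz by (simp only: inverse_divide)
      show ?thesis
        unfolding Suc X inverse_mult_distrib[symmetric] by (subst prod.cl_ivl_Suc) simp
    qed
    finally show ?case .
  qed
  then have "(\<lambda>m. (wallis_ratio m)\<^sup>2 * (2 * real m + 1)) \<longlonglongrightarrow> inverse (pi / 2)"
    by (simp only:) (intro tendsto_inverse wallis, simp)
  then have "(\<lambda>m. sqrt ((wallis_ratio m)\<^sup>2 * (2 * real m + 1))) \<longlonglongrightarrow> sqrt (inverse (pi / 2))"
    by (rule tendsto_real_sqrt)
  then show ?thesis
    by (simp add: real_sqrt_mult wallis_ratio_nonneg)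
qed

lemma hermite_at_0:
  fixes v :: real
  assumes "v > 0"
  shows "hermite v (2 * m + 1) 0 = 0"
    and "(hermite v (2 * m) 0)\<^sup>2 = fact (2 * m) * v ^ (2 * m) * wallis_ratio m"
proof -
  show "hermite v (2 * m + 1) 0 = 0" by (induction m) auto
  show "(hermite v (2 * m) 0)\<^sup>2 = fact (2 * m) * v ^ (2 * m) * wallis_ratio m"
  proof (induction m)
    case (Suc m)
    have "hermite v (2 * Suc m) 0 = - (v * real (2 * m + 1) * hermite v (2 * m) 0)"
      by simp
    then have "(hermite v (2 * Suc m) 0)\<^sup>2 = (v * real (2 * m + 1))\<^sup>2 * (hermite v (2 * m) 0)\<^sup>2"
      by (simp only: power2_minus power_mult_distrib)
    also have "\<dots> = fact (2 * Suc m) * v ^ (2 * Suc m) * wallis_ratio (Suc m)"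
      unfolding Suc by (simp add: wallis_ratio_def power2_eq_square field_simps)
    finally show ?case .
  qed (simp add: wallis_ratio_def)
qed

text \<open>
  The energy \<open>f'\<^sup>2 + q f\<^sup>2\<close> for the coefficient \<open>q\<close> of the oscillator equation \<open>hermite_function_ode\<close>.
\<close>
definition hermite_energy :: "real \<Rightarrow> nat \<Rightarrow> real \<Rightarrow> real" where
  "hermite_energy v n x = (hermite_function' v n x)\<^sup>2 +
     ((real n + 1 / 2 - x\<^sup>2 / (4 * v)) / v) * (hermite_function v n x)\<^sup>2"

lemma hermite_energy_kernel:
  assumes "v \<noteq> 0"
  shows "v * hermite_energy v n x = fact n * v ^ n * hermite_kernel v n x + (hermite_function v n x)\<^sup>2 / 2"
  unfolding hermite_kernel_energy[OF assms] hermite_energy_def using assms by (simp add: field_simps)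

text \<open>
  At the origin the energy is purely potential for even \<open>n\<close> and purely kinetic for odd \<open>n\<close>; in both cases it is
  given by a Wallis ratio. The factor \<open>n + 1/2\<close> instead of \<open>sqrt (n (n + 1))\<close> in the even case accounts
  for the relative error \<open>1/n\<close> in the estimate.
\<close>
lemma hermite_energy_0_limit:
  "(\<lambda>n. (1 / real n) * hermite_energy (1 / real n) n 0 / (fact n * (1 / real n) ^ n) / sqrt (real n)) \<longlonglongrightarrow> sqrt (2 / pi)"
proof -
  define g where "g n = (1 / real n) * hermite_energy (1 / real n) n 0 / (fact n * (1 / real n) ^ n) / sqrt (real n)" for n
  define t where "t n = wallis_ratio (n div 2) * sqrt (2 * real (n div 2) + 1)" for n
  have half: "filterlim (\<lambda>n::nat. n div 2) at_top sequentially"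
    unfolding filterlim_at_top eventually_sequentially by (intro allI, rule_tac x = "2 * Z" in exI) auto
  have t: "t \<longlonglongrightarrow> sqrt (2 / pi)"
    unfolding t_def by (rule filterlim_compose[OF wallis_ratio_limit half])
  have t0: "t n \<ge> 0" for n by (simp add: t_def wallis_ratio_nonneg)
  have bounds: "t n \<le> g n \<and> g n \<le> (1 + 1 / real n) * t n" if n: "n > 0" for n
  proof (cases "even n")
    case True
    then obtain m where m: "n = 2 * m" by auto
    then have m0: "m > 0" using n by simp
    have v: "1 / real n > 0" using n by simp
    have d0: "hermite (1 / real n) (n - 1) 0 = 0"
      using hermite_at_0(1)[OF v, of "m - 1"] m0 m by (simp add: numeral_2_eq_2 Suc_diff_Suc)
    have "g n = (real n + 1 / 2) * wallis_ratio m / sqrt (real n)"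
      unfolding g_def hermite_energy_def hermite_function_def hermite_function'_def d0
      using n hermite_at_0(2)[OF v, of m] unfolding m by (simp add: gauss_weight_def power_mult_distrib)
    then have g: "g n = t n * ((real n + 1 / 2) / sqrt (real n * (real n + 1)))"
      using m n by (simp add: t_def real_sqrt_mult)
    have "sqrt (real n * (real n + 1)) \<le> real n + 1 / 2"
      by (rule real_le_lsqrt) (auto simp: power2_eq_square algebra_simps)
    then have "1 \<le> (real n + 1 / 2) / sqrt (real n * (real n + 1))"
      using n by (subst le_divide_eq_1_pos) auto
    moreover have "(real n + 1 / 2) / sqrt (real n * (real n + 1)) \<le> 1 + 1 / real n"
    proof -
      have "real n \<le> sqrt (real n * (real n + 1))"
        by (rule real_le_rsqrt) (auto simp: power2_eq_square algebra_simps)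
      then have "(real n + 1 / 2) / sqrt (real n * (real n + 1)) \<le> (real n + 1 / 2) / real n"
        using n by (intro divide_left_mono) auto
      also have "\<dots> \<le> 1 + 1 / real n" using n by (simp add: field_simps)
      finally show ?thesis .
    qed
    ultimately show ?thesis
      unfolding g using mult_left_mono[OF _ t0] by (metis mult.commute mult.right_neutral)
  next
    case False
    then obtain m where m: "n = 2 * m + 1" by (auto elim: oddE)
    have v: "1 / real n > 0" using n by simp
    have d0: "hermite (1 / real n) n 0 = 0"
      using hermite_at_0(1)[OF v, of m] m by simp
    have "(hermite (1 / real n) (n - 1) 0)\<^sup>2 = fact (2 * m) * (1 / real n) ^ (2 * m) * wallis_ratio m"
      using hermite_at_0(2)[OF v, of m] m by simp
    then have "g n = (1 / real n) * ((real n)\<^sup>2 * (fact (2 * m) * (1 / real n) ^ (2 * m) * wallis_ratio m)) / (fact n * (1 / real n) ^ n) / sqrt (real n)"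
      unfolding g_def hermite_energy_def hermite_function_def hermite_function'_def d0
      by (simp add: gauss_weight_def power_mult_distrib)
    also have "\<dots> = real n * wallis_ratio m / sqrt (real n)"
    proof -
      have "fact n * (1 / real n) ^ n = fact (2 * m) * (1 / real n) ^ (2 * m)"
        using n unfolding m by simp
      then show ?thesis using n by (simp add: power2_eq_square)
    qed
    also have "\<dots> = wallis_ratio m * sqrt (real n)"
      using n by (simp add: field_simps)
    also have "\<dots> = t n" using m by (simp add: t_def)
    finally show ?thesis using t0[of n] n by (simp add: field_simps)
  qed
  have "(\<lambda>n. (1 + 1 / real n) * t n) \<longlonglongrightarrow> (1 + 0) * sqrt (2 / pi)"
    by (intro tendsto_intros t lim_1_over_n)
  then have "g \<longlonglongrightarrow> sqrt (2 / pi)"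
    using bounds by (intro tendsto_sandwich[OF _ _ t, of g])
      (auto simp: eventually_sequentially intro!: exI[of _ 1])
  then show ?thesis unfolding g_def .
qed

lemma one_minus_quarter_square_pos:
  fixes x :: real
  assumes "- 2 < x" "x < 2"
  shows "1 - x\<^sup>2 / 4 > 0"
proof -
  have "\<bar>x\<bar> ^ 2 < 2 ^ 2" using assms by (intro power_strict_mono) auto
  then show ?thesis by simp
qed

text \<open>
  The adiabatic invariant transports the energy from the origin to \<open>x\<close>. With \<open>v = 1/n\<close> the coefficient \<open>Q n\<close> and its
  derivatives are all of order \<open>n\<^sup>2\<close>, so the derivative of \<open>L n\<close> is \<open>O(1/n)\<close>; the oscillating correction
  and the difference between energy and kernel are of relative size \<open>O(1/n)\<close> as well.
\<close>
theorem hermite_kernel_semicircle: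
  assumes x: "- 2 < x" "x < 2"
  shows "(\<lambda>n. hermite_kernel (1 / real n) n x / sqrt (real n)) \<longlonglongrightarrow> sqrt (2 / pi) * sqrt (1 - x\<^sup>2 / 4)"
proof -
  define \<delta> where "\<delta> = 1 - x\<^sup>2 / 4"
  have \<delta>: "\<delta> > 0" "\<delta> \<le> 1"
    using one_minus_quarter_square_pos[OF x] by (auto simp: \<delta>_def)
  \<comment> \<open>From the bounds \<open>n\<^sup>2/2\<close>, \<open>n\<^sup>4\<close> and \<open>n\<^sup>2 \<delta>\<close> for the second derivative of \<open>Q n\<close>,
  the square of its first derivative, and \<open>Q n\<close> itself.\<close>
  define C where "C = (1 / (4 * \<delta>) + 1 / \<delta>\<^sup>2) / (2 * sqrt \<delta>)"
  define Q where "Q n y = (real n + 1 / 2 - y\<^sup>2 / (4 * (1 / real n))) / (1 / real n)" for n y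
  define G where "G n y = hermite_energy (1 / real n) n y" for n y
  define s where "s n y = hermite_function (1 / real n) n y * hermite_function' (1 / real n) n y / G n y" for n y
  define Q' where "Q' n y = - ((real n)\<^sup>2 * y / 2)" for n y
  define L where "L n y = ln (G n y) - ln (Q n y) / 2 + Q' n y / (2 * Q n y) * s n y" for n y
  have Qeq: "Q n y = (real n)\<^sup>2 * (1 - y\<^sup>2 / 4) + real n / 2" for n y
    by (cases "n = 0") (simp_all add: Q_def field_simps power2_eq_square)
  have Qge: "Q n y \<ge> (real n)\<^sup>2 * \<delta>" if "\<bar>y\<bar> \<le> \<bar>x\<bar>" for n y
  proof -
    have "y\<^sup>2 \<le> x\<^sup>2" using that by (simp add: abs_le_square_iff)
    then have "(real n)\<^sup>2 * \<delta> \<le> (real n)\<^sup>2 * (1 - y\<^sup>2 / 4)"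
      by (intro mult_left_mono) (auto simp: \<delta>_def)
    then show ?thesis by (simp add: Qeq)
  qed
  have Gpos: "G n y > 0" if "n > 0" for n y
  proof -
    have "0 < fact n * (1 / real n) ^ n * hermite_kernel (1 / real n) n y"
      using that by (simp add: hermite_kernel_pos)
    also have "\<dots> \<le> (1 / real n) * G n y"
      unfolding G_def using that by (subst hermite_energy_kernel) auto
    finally show ?thesis using that by (simp add: zero_less_divide_iff)
  qed
  have Qpos: "Q n y > 0" if "n > 0" "\<bar>y\<bar> \<le> \<bar>x\<bar>" for n y
    using Qge[OF that(2), of n] that \<delta> by (smt (verit) mult_pos_pos of_nat_0_less_iff zero_less_power)
  have sqrtQ: "sqrt (Q n y) \<ge> real n * sqrt \<delta>" if "\<bar>y\<bar> \<le> \<bar>x\<bar>" for n y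
  proof -
    have "real n * sqrt \<delta> = sqrt ((real n)\<^sup>2 * \<delta>)" by (simp add: real_sqrt_mult)
    also have "\<dots> \<le> sqrt (Q n y)" using Qge[OF that] by simp
    finally show ?thesis .
  qed
  have xy: "\<bar>y\<bar> \<le> \<bar>x\<bar>" if "y \<in> {- \<bar>x\<bar>..\<bar>x\<bar>}" for y using that by auto
  have L: "\<bar>L n x - L n 0\<bar> \<le> C / real n * \<bar>x - 0\<bar>" if n: "n > 0" for n
    unfolding L_def s_def G_def hermite_energy_def Q_def[symmetric]
  proof (rule adiabatic_invariant[where S = "{- \<bar>x\<bar>..\<bar>x\<bar>}" and Q'' = "\<lambda>y. - ((real n)\<^sup>2 / 2)"])
    fix y assume y: "y \<in> {- \<bar>x\<bar>..\<bar>x\<bar>}"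
    show "(hermite_function (1 / real n) n has_field_derivative hermite_function' (1 / real n) n y) (at y)"
      using n by (intro hermite_function_deriv) auto
    show "(hermite_function' (1 / real n) n has_field_derivative - Q n y * hermite_function (1 / real n) n y) (at y)"
      unfolding Q_def using n by (intro hermite_function_ode) auto
    show "(Q n has_field_derivative Q' n y) (at y)"
      unfolding Qeq[abs_def] Q'_def by (auto intro!: derivative_eq_intros)
    show "(Q' n has_field_derivative - ((real n)\<^sup>2 / 2)) (at y)"
      unfolding Q'_def[abs_def] by (auto intro!: derivative_eq_intros)
    show "Q n y > 0" by (rule Qpos[OF n xy[OF y]])
    show "0 < (hermite_function' (1 / real n) n y)\<^sup>2 + Q n y * (hermite_function (1 / real n) n y)\<^sup>2"
      using Gpos[OF n, of y] unfolding G_def hermite_energy_def Q_def .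
    have nd: "(real n)\<^sup>2 * \<delta> > 0" using n \<delta> by simp
    have y2: "y\<^sup>2 \<le> 4"
    proof -
      have "y\<^sup>2 \<le> x\<^sup>2" using xy[OF y] by (simp add: abs_le_square_iff)
      then show ?thesis using \<delta> by (simp add: \<delta>_def)
    qed
    have "(\<bar>- ((real n)\<^sup>2 / 2)\<bar> / (2 * Q n y) + (Q' n y)\<^sup>2 / (Q n y)\<^sup>2) / (2 * sqrt (Q n y)) \<le>
      (((real n)\<^sup>2 / 2) / (2 * ((real n)\<^sup>2 * \<delta>)) + (real n) ^ 4 / ((real n)\<^sup>2 * \<delta>)\<^sup>2) / (2 * (real n * sqrt \<delta>))"
    proof (intro frac_le add_mono)
      show "\<bar>- ((real n)\<^sup>2 / 2)\<bar> \<le> (real n)\<^sup>2 / 2" by simp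
      show "2 * ((real n)\<^sup>2 * \<delta>) \<le> 2 * Q n y" using Qge[OF xy[OF y]] by simp
      show "((real n)\<^sup>2 * \<delta>)\<^sup>2 \<le> (Q n y)\<^sup>2" using Qge[OF xy[OF y]] nd by (intro power_mono) auto
      show "2 * (real n * sqrt \<delta>) \<le> 2 * sqrt (Q n y)" using sqrtQ[OF xy[OF y]] by simp
      have "(Q' n y)\<^sup>2 = (real n) ^ 4 * (y\<^sup>2 / 4)"
        by (simp add: Q'_def power2_eq_square power4_eq_xxxx)
      also have "\<dots> \<le> (real n) ^ 4 * 1" using y2 by (intro mult_left_mono) auto
      finally show "(Q' n y)\<^sup>2 \<le> (real n) ^ 4" by simp
    qed (use nd n \<delta> in auto)
    also have "\<dots> = C / real n"
      unfolding C_def using n \<delta> by (simp add: field_simps power2_eq_square power4_eq_xxxx)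
    finally show "(\<bar>- ((real n)\<^sup>2 / 2)\<bar> / (2 * Q n y) + (Q' n y)\<^sup>2 / (Q n y)\<^sup>2) / (2 * sqrt (Q n y)) \<le> C / real n" .
  qed auto
  have s: "\<bar>s n x\<bar> \<le> 1 / (2 * sqrt (Q n x))" if n: "n > 0" for n
    using product_le_energy[OF Qpos[OF n, of x]] Gpos[OF n, of x]
    unfolding s_def G_def hermite_energy_def Q_def[symmetric] by simp
  have limn: "(\<lambda>n. c / real n) \<longlonglongrightarrow> 0" for c by (rule lim_const_over_n)
  have corr: "(\<lambda>n. Q' n x / (2 * Q n x) * s n x) \<longlonglongrightarrow> 0"
  proof (rule Lim_null_comparison[OF _ limn], rule eventually_sequentiallyI)
    fix n :: nat assume "1 \<le> n"
    then have n: "n > 0" by simp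
    have nd: "(real n)\<^sup>2 * \<delta> > 0" using n \<delta> by simp
    have "norm (Q' n x / (2 * Q n x) * s n x) = \<bar>Q' n x\<bar> / (2 * Q n x) * \<bar>s n x\<bar>"
      using Qpos[OF n, of x] by (simp add: abs_mult)
    also have "\<dots> \<le> (real n)\<^sup>2 / (2 * ((real n)\<^sup>2 * \<delta>)) * (1 / (2 * (real n * sqrt \<delta>)))"
    proof (intro mult_mono frac_le order_trans[OF s[OF n]])
      show "\<bar>Q' n x\<bar> \<le> (real n)\<^sup>2"
      proof -
        have "\<bar>Q' n x\<bar> = (real n)\<^sup>2 * (\<bar>x\<bar> / 2)" by (simp add: Q'_def abs_mult)
        also have "\<dots> \<le> (real n)\<^sup>2 * 1" using x by (intro mult_left_mono) auto
        finally show ?thesis by simp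
      qed
    qed (use nd n \<delta> Qge[of x n] sqrtQ[of x n] in auto)
    also have "\<dots> = (1 / (4 * \<delta> * sqrt \<delta>)) / real n"
      using n by (simp add: field_simps)
    finally show "norm (Q' n x / (2 * Q n x) * s n x) \<le> (1 / (4 * \<delta> * sqrt \<delta>)) / real n" .
  qed
  have Ldiff: "(\<lambda>n. L n x - L n 0) \<longlonglongrightarrow> 0"
  proof (rule Lim_null_comparison[OF _ limn], rule eventually_sequentiallyI)
    fix n :: nat assume "1 \<le> n"
    then show "norm (L n x - L n 0) \<le> (C * \<bar>x\<bar>) / real n" using L[of n] by simp
  qed
  have "(\<lambda>n. exp ((L n x - L n 0) - Q' n x / (2 * Q n x) * s n x)) \<longlonglongrightarrow> exp (0 - 0)"
    by (intro tendsto_intros Ldiff corr)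
  then have ratio0: "(\<lambda>n. exp ((L n x - L n 0) - Q' n x / (2 * Q n x) * s n x)) \<longlonglongrightarrow> 1" by simp
  \<comment> \<open>The correction term in \<open>L n\<close> vanishes at the origin, because the derivative of \<open>Q n\<close> does.\<close>
  have ratio: "(\<lambda>n. G n x / G n 0 * sqrt (Q n 0 / Q n x)) \<longlonglongrightarrow> 1"
  proof (rule Lim_transform_eventually[OF ratio0], rule eventually_sequentiallyI)
    fix n :: nat assume "1 \<le> n"
    then have n: "n > 0" by simp
    note pos = Gpos[OF n, of x] Gpos[OF n, of 0] Qpos[OF n, of x] Qpos[OF n, of 0]
    have "(L n x - L n 0) - Q' n x / (2 * Q n x) * s n x = (ln (G n x) - ln (G n 0)) + (ln (Q n 0) - ln (Q n x)) / 2"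
      by (simp add: L_def Q'_def field_simps)
    also have "\<dots> = ln (G n x / G n 0) + ln (sqrt (Q n 0 / Q n x))"
      using pos by (simp add: ln_div ln_sqrt)
    also have "\<dots> = ln (G n x / G n 0 * sqrt (Q n 0 / Q n x))"
      using pos by (subst ln_mult) auto
    finally show "exp ((L n x - L n 0) - Q' n x / (2 * Q n x) * s n x) = G n x / G n 0 * sqrt (Q n 0 / Q n x)"
      using pos by simp
  qed
  have Qn: "(\<lambda>n. Q n y / (real n)\<^sup>2) \<longlonglongrightarrow> 1 - y\<^sup>2 / 4" for y
  proof -
    have "(\<lambda>n. (1 - y\<^sup>2 / 4) + (1 / 2) / real n) \<longlonglongrightarrow> (1 - y\<^sup>2 / 4) + 0"
      by (intro tendsto_intros limn)
    then have "(\<lambda>n. (1 - y\<^sup>2 / 4) + (1 / 2) / real n) \<longlonglongrightarrow> 1 - y\<^sup>2 / 4" by simp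
    then show ?thesis
      by (rule Lim_transform_eventually, intro eventually_sequentiallyI[of 1])
        (simp add: Qeq field_simps power2_eq_square)
  qed
  have Qratio: "(\<lambda>n. sqrt (Q n x / Q n 0)) \<longlonglongrightarrow> sqrt \<delta>"
  proof -
    have "(\<lambda>n. sqrt ((Q n x / (real n)\<^sup>2) / (Q n 0 / (real n)\<^sup>2))) \<longlonglongrightarrow> sqrt ((1 - x\<^sup>2 / 4) / (1 - 0\<^sup>2 / 4))"
      by (intro tendsto_real_sqrt tendsto_divide Qn) simp
    then have "(\<lambda>n. sqrt ((Q n x / (real n)\<^sup>2) / (Q n 0 / (real n)\<^sup>2))) \<longlonglongrightarrow> sqrt \<delta>" by (simp add: \<delta>_def)
    then show ?thesis
      by (rule Lim_transform_eventually, intro eventually_sequentiallyI[of 1]) simp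
  qed
  define g where "g n y = (1 / real n) * G n y / (fact n * (1 / real n) ^ n) / sqrt (real n)" for n y
  have "(\<lambda>n. (G n x / G n 0 * sqrt (Q n 0 / Q n x)) * sqrt (Q n x / Q n 0) * g n 0) \<longlonglongrightarrow> 1 * sqrt \<delta> * sqrt (2 / pi)"
    unfolding g_def G_def by (intro tendsto_mult Qratio hermite_energy_0_limit ratio[unfolded G_def])
  then have glim: "(\<lambda>n. g n x) \<longlonglongrightarrow> sqrt (2 / pi) * sqrt \<delta>"
    unfolding mult_1 mult.commute[of "sqrt \<delta>"]
  proof (rule Lim_transform_eventually, intro eventually_sequentiallyI[of 1])
    fix n :: nat assume "1 \<le> n"
    then have n: "n > 0" by simp
    note pos = Gpos[OF n, of x] Gpos[OF n, of 0] Qpos[OF n, of x] Qpos[OF n, of 0]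
    have "sqrt (Q n 0 / Q n x) * sqrt (Q n x / Q n 0) = 1"
      using pos unfolding real_sqrt_mult[symmetric] by simp
    then have "(G n x / G n 0 * sqrt (Q n 0 / Q n x)) * sqrt (Q n x / Q n 0) * g n 0 = G n x / G n 0 * g n 0"
      by (metis (no_types, lifting) mult.assoc mult.right_neutral)
    also have "\<dots> = g n x" unfolding g_def using pos by (simp add: divide_simps)
    finally show "(G n x / G n 0 * sqrt (Q n 0 / Q n x)) * sqrt (Q n x / Q n 0) * g n 0 = g n x" .
  qed
  \<comment> \<open>The fraction of the energy by which it exceeds the kernel.\<close>
  define e where "e n = (hermite_function (1 / real n) n x)\<^sup>2 / (2 * ((1 / real n) * G n x))" for n
  have e0: "e \<longlonglongrightarrow> 0"
  proof (rule Lim_null_comparison[OF _ limn], rule eventually_sequentiallyI)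
    fix n :: nat assume "1 \<le> n"
    then have n: "n > 0" by simp
    have nd: "(real n)\<^sup>2 * \<delta> > 0" using n \<delta> by simp
    have "(real n)\<^sup>2 * \<delta> * (hermite_function (1 / real n) n x)\<^sup>2 \<le> Q n x * (hermite_function (1 / real n) n x)\<^sup>2"
      by (intro mult_right_mono Qge) auto
    also have "\<dots> \<le> G n x" by (simp add: G_def hermite_energy_def Q_def)
    finally have "(hermite_function (1 / real n) n x)\<^sup>2 / G n x \<le> 1 / ((real n)\<^sup>2 * \<delta>)"
      using Gpos[OF n, of x] nd by (simp add: field_simps)
    then have "real n / 2 * ((hermite_function (1 / real n) n x)\<^sup>2 / G n x) \<le> real n / 2 * (1 / ((real n)\<^sup>2 * \<delta>))"
      by (intro mult_left_mono) auto
    also have "\<dots> = (1 / (2 * \<delta>)) / real n" using n by (simp add: field_simps power2_eq_square)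
    finally show "norm (e n) \<le> (1 / (2 * \<delta>)) / real n"
      using Gpos[OF n, of x] n by (simp add: e_def mult.commute)
  qed
  have "(\<lambda>n. g n x * (1 - e n)) \<longlonglongrightarrow> sqrt (2 / pi) * sqrt \<delta> * (1 - 0)"
    by (intro tendsto_intros glim e0)
  then have "(\<lambda>n. hermite_kernel (1 / real n) n x / sqrt (real n)) \<longlonglongrightarrow> sqrt (2 / pi) * sqrt \<delta> * (1 - 0)"
  proof (rule Lim_transform_eventually, intro eventually_sequentiallyI[of 1])
    fix n :: nat assume "1 \<le> n"
    then have n: "n > 0" by simp
    define c :: real where "c = fact n * (1 / real n) ^ n"
    have c: "c > 0" unfolding c_def using n by simp
    have "(1 / real n) * G n x * (1 - e n) = (1 / real n) * G n x - (hermite_function (1 / real n) n x)\<^sup>2 / 2"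
      unfolding e_def right_diff_distrib using Gpos[OF n, of x] n by simp
    also have "\<dots> = c * hermite_kernel (1 / real n) n x"
      unfolding G_def c_def using n by (subst hermite_energy_kernel) auto
    finally have "(1 / real n) * G n x * (1 - e n) = c * hermite_kernel (1 / real n) n x" .
    moreover have "g n x * (1 - e n) = ((1 / real n) * G n x * (1 - e n)) / c / sqrt (real n)"
      unfolding g_def c_def by simp
    ultimately show "g n x * (1 - e n) = hermite_kernel (1 / real n) n x / sqrt (real n)"
      using c by simp
  qed
  then show ?thesis by (simp add: \<delta>_def)
qed

section \<open>Binomial thinning of the Hermite kernel\<close>

text \<open>
  The expectation of \<open>f\<close> under the binomial distribution, kept as a finite sum because in this form it arises from the
  integral over vertical lines and obeys the identities below.
\<close>
definition binomial_mean :: "real \<Rightarrow> nat \<Rightarrow> (nat \<Rightarrow> real) \<Rightarrow> real" where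
  "binomial_mean p n f = (\<Sum>k\<le>n. real (n choose k) * (p ^ k * (1 - p) ^ (n - k)) * f k)"

text \<open>
  Conditioning on the last of \<open>n + 1\<close> trials.
\<close>
lemma binomial_mean_Suc:
  "binomial_mean p (Suc n) f = (1 - p) * binomial_mean p n f + p * binomial_mean p n (\<lambda>k. f (Suc k))"
proof -
  have "binomial_mean p (Suc n) f = (\<Sum>k\<le>Suc n. of_nat (Suc n choose k) * (p ^ k * (1 - p) ^ (Suc n - k) * f k))"
    by (simp only: binomial_mean_def mult.assoc)
  also have "\<dots> = (\<Sum>k\<le>n. of_nat (n choose k) * (p ^ Suc k * (1 - p) ^ (n - k) * f (Suc k) + p ^ k * (1 - p) ^ Suc (n - k) * f k))"
    by (rule sum_binomial_Suc[where f = "\<lambda>i j. p ^ i * (1 - p) ^ j * f i"])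
  also have "\<dots> = (1 - p) * binomial_mean p n f + p * binomial_mean p n (\<lambda>k. f (Suc k))"
    unfolding binomial_mean_def sum_distrib_left sum.distrib[symmetric]
    by (intro sum.cong refl) (simp add: algebra_simps)
  finally show ?thesis .
qed

lemma binomial_mean_add: "binomial_mean p n (\<lambda>k. f k + g k) = binomial_mean p n f + binomial_mean p n g"
  and binomial_mean_cmult: "binomial_mean p n (\<lambda>k. c * f k) = c * binomial_mean p n f"
  unfolding binomial_mean_def by (simp_all add: sum.distrib sum_distrib_left algebra_simps)

lemma binomial_mean_mono:
  assumes "0 \<le> p" "p \<le> 1" "\<And>k. k \<le> n \<Longrightarrow> f k \<le> g k"
  shows "binomial_mean p n f \<le> binomial_mean p n g"
  unfolding binomial_mean_def using assms by (intro sum_mono mult_left_mono) auto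

lemma binomial_mean_const: "binomial_mean p n (\<lambda>_. c) = c"
  by (induction n) (simp_all add: binomial_mean_Suc, simp_all add: binomial_mean_def algebra_simps)

lemma binomial_mean_index: "binomial_mean p n real = real n * p"
proof (induction n)
  case (Suc n)
  have "binomial_mean p n (\<lambda>k. real (Suc k)) = binomial_mean p n real + 1"
    using binomial_mean_add[of p n real "\<lambda>_. 1"] by (simp add: binomial_mean_const algebra_simps)
  then show ?case unfolding binomial_mean_Suc Suc by (simp add: algebra_simps)
qed (simp add: binomial_mean_def)

text \<open>
  If \<open>S n\<close> counts the successes in \<open>n\<close> trials, then each success raises the partial sum of \<open>u\<close> up to \<open>S n\<close>
  by \<open>u (S n)\<close>; taking expectations, the increment is \<open>p\<close> times the mean of \<open>u (S n)\<close>.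
\<close>
lemma binomial_mean_telescope:
  "p * (\<Sum>n<m. binomial_mean p n u) = binomial_mean p m (\<lambda>k. \<Sum>j<k. u j)"
proof (induction m)
  case (Suc m)
  have "binomial_mean p m (\<lambda>k. \<Sum>j<Suc k. u j) = binomial_mean p m (\<lambda>k. \<Sum>j<k. u j) + binomial_mean p m u"
    by (simp add: binomial_mean_add)
  then show ?case unfolding binomial_mean_Suc by (simp add: Suc[symmetric] algebra_simps)
qed (simp add: binomial_mean_def)

text \<open>
  Since \<open>\<delta>\<close> is half the distance of \<open>x\<^sup>2/4\<close> from \<open>1\<close>, levels \<open>k \<ge> (1 - \<delta>) n\<close> satisfy
  \<open>k - n x\<^sup>2/4 \<ge> \<delta> n\<close>, and each of them carries at most the fraction \<open>1 / (\<delta> n)\<close> of the kernel. For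
  \<open>m < (1 - \<delta>) n\<close> the factor on the right exceeds \<open>1\<close>. Linearity in \<open>m\<close> is what lets the bound be averaged.
\<close>
lemma hermite_kernel_near_top:
  assumes n: "n > 0" and m: "m \<le> n" and x: "- 2 < x" "x < 2"
  defines "\<delta> \<equiv> (1 - x\<^sup>2 / 4) / 2"
  shows "hermite_kernel (1 / real n) n x - hermite_kernel (1 / real n) m x \<le>
    (real n - real m) / (\<delta> * real n) * hermite_kernel (1 / real n) n x"
proof -
  have \<delta>: "\<delta> > 0"
    using one_minus_quarter_square_pos[OF x] by (simp add: \<delta>_def)
  define K where "K k = hermite_kernel (1 / real n) k x" for k
  have v: "1 / real n > 0" using n by simp
  have K0: "K n > 0" unfolding K_def using v n by (rule hermite_kernel_pos)
  show ?thesis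
  proof (cases "real m \<ge> (1 - \<delta>) * real n")
    case True
    have "hermite_density (1 / real n) k x \<le> K n / (\<delta> * real n)" if k: "m \<le> k" "k < n" for k
    proof -
      have "\<delta> * real n \<le> real k - x\<^sup>2 / (4 * (1 / real n))"
      proof -
        have "(1 - \<delta>) * real n \<le> real k" using True k by linarith
        then show ?thesis unfolding \<delta>_def by (simp add: field_simps)
      qed
      then have "\<delta> * real n * hermite_density (1 / real n) k x \<le>
          (real k - x\<^sup>2 / (4 * (1 / real n))) * hermite_density (1 / real n) k x"
        by (intro mult_right_mono hermite_density_nonneg v)
      also have "\<dots> \<le> K k" unfolding K_def by (rule hermite_density_le_kernel[OF v])
      also have "\<dots> \<le> K n" unfolding K_def using k by (intro hermite_kernel_mono v) auto
      finally show ?thesis using \<delta> n by (simp add: field_simps)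
    qed
    then have "(\<Sum>k=m..<n. hermite_density (1 / real n) k x) \<le> real (card {m..<n}) * (K n / (\<delta> * real n))"
      by (intro sum_bounded_above) auto
    moreover have "K n - K m = (\<Sum>k=m..<n. hermite_density (1 / real n) k x)"
      using m sum_diff_nat_ivl[of 0 m n "\<lambda>k. hermite_density (1 / real n) k x"]
      by (simp add: K_def hermite_kernel_def atLeast0LessThan)
    ultimately show ?thesis using m by (simp add: K_def of_nat_diff field_simps)
  next
    case False
    then have "1 \<le> (real n - real m) / (\<delta> * real n)"
      using n \<delta> by (simp add: field_simps)
    then have "1 * K n \<le> (real n - real m) / (\<delta> * real n) * K n"
      using K0 by (intro mult_right_mono) auto
    moreover have "K m \<ge> 0" unfolding K_def hermite_kernel_def by (intro sum_nonneg hermite_density_nonneg v)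
    ultimately show ?thesis unfolding K_def by linarith
  qed
qed

text \<open>
  Multiplied by \<open>p n\<close>, the thinned sum is squeezed between \<open>K n n\<close> and \<open>K n n\<close> times one minus a multiple of the expected fraction \<open>1 - p n\<close> of
  missing levels.
\<close>
theorem thinned_hermite_kernel_semicircle:
  assumes x: "- 2 < x" "x < 2" and p: "p \<longlonglongrightarrow> 1" "\<And>n. 0 < p n" "\<And>n. p n \<le> 1"
  shows "(\<lambda>n. (\<Sum>k<n. binomial_mean (p n) k (\<lambda>j. hermite_density (1 / real n) j x)) / sqrt (real n))
    \<longlonglongrightarrow> sqrt (2 / pi) * sqrt (1 - x\<^sup>2 / 4)"
proof -
  define K where "K n k = hermite_kernel (1 / real n) k x" for n k
  define T where "T n = (\<Sum>k<n. binomial_mean (p n) k (\<lambda>j. hermite_density (1 / real n) j x))" for n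
  define \<delta> where "\<delta> = (1 - x\<^sup>2 / 4) / 2"
  have T: "p n * T n = binomial_mean (p n) n (K n)" for n
    unfolding T_def binomial_mean_telescope K_def hermite_kernel_def[abs_def] ..
  have upper: "p n * T n \<le> K n n" and lower: "(1 - (1 - p n) / \<delta>) * K n n \<le> p n * T n" if n: "n > 0" for n
  proof -
    have v: "1 / real n > 0" using n by simp
    have "binomial_mean (p n) n (K n) \<le> binomial_mean (p n) n (\<lambda>_. K n n)"
      using p(2)[of n] p(3)[of n] unfolding K_def
      by (intro binomial_mean_mono hermite_kernel_mono v) auto
    then show "p n * T n \<le> K n n" by (simp add: T binomial_mean_const)
    \<comment> \<open>The lower bound for \<open>K n m\<close> is affine in \<open>m\<close>, so only the binomial mean \<open>n p\<close> enters.\<close>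
    have "binomial_mean (p n) n (\<lambda>m. (1 - 1 / \<delta>) * K n n + K n n / (\<delta> * real n) * real m) \<le> binomial_mean (p n) n (K n)"
    proof (intro binomial_mean_mono)
      fix m assume m: "m \<le> n"
      have "K n n - K n m \<le> (real n - real m) / (\<delta> * real n) * K n n"
        unfolding K_def \<delta>_def by (rule hermite_kernel_near_top[OF n m x])
      also have "\<dots> = K n n / \<delta> - K n n / (\<delta> * real n) * real m"
        using n by (simp add: divide_simps) (simp add: algebra_simps)
      finally show "(1 - 1 / \<delta>) * K n n + K n n / (\<delta> * real n) * real m \<le> K n m"
        by (simp add: algebra_simps)
    qed (use p(2)[of n] p(3)[of n] in auto)
    also have "binomial_mean (p n) n (\<lambda>m. (1 - 1 / \<delta>) * K n n + K n n / (\<delta> * real n) * real m) =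
      (1 - 1 / \<delta>) * K n n + K n n / (\<delta> * real n) * (real n * p n)"
      by (simp only: binomial_mean_add binomial_mean_cmult binomial_mean_const binomial_mean_index)
    also have "\<dots> = (1 - (1 - p n) / \<delta>) * K n n"
      using n by (simp add: algebra_simps diff_divide_distrib)
    finally show "(1 - (1 - p n) / \<delta>) * K n n \<le> p n * T n" by (simp add: T)
  qed
  define s where "s = sqrt (2 / pi) * sqrt (1 - x\<^sup>2 / 4)"
  have K: "(\<lambda>n. K n n / sqrt (real n)) \<longlonglongrightarrow> s"
    unfolding K_def s_def by (rule hermite_kernel_semicircle[OF x])
  have "\<delta> > 0"
    using one_minus_quarter_square_pos[OF x] by (simp add: \<delta>_def)
  then have "(\<lambda>n. (1 - (1 - p n) / \<delta>) * (K n n / sqrt (real n))) \<longlonglongrightarrow> (1 - (1 - 1) / \<delta>) * s"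
    by (intro tendsto_intros p K) auto
  then have lo: "(\<lambda>n. (1 - (1 - p n) / \<delta>) * (K n n / sqrt (real n))) \<longlonglongrightarrow> s" by simp
  have "(\<lambda>n. p n * T n / sqrt (real n)) \<longlonglongrightarrow> s"
  proof (rule tendsto_sandwich[OF _ _ lo K]; rule eventually_sequentiallyI[of 1])
    fix n :: nat assume "1 \<le> n"
    then have n: "n > 0" by simp
    show "(1 - (1 - p n) / \<delta>) * (K n n / sqrt (real n)) \<le> p n * T n / sqrt (real n)"
      using divide_right_mono[OF lower[OF n], of "sqrt (real n)"] by simp
    show "p n * T n / sqrt (real n) \<le> K n n / sqrt (real n)"
      using upper[OF n] by (intro divide_right_mono) auto
  qed
  then have "(\<lambda>n. (p n * T n / sqrt (real n)) / p n) \<longlonglongrightarrow> s / 1"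
    by (intro tendsto_divide p(1)) auto
  moreover have "(p n * T n / sqrt (real n)) / p n = T n / sqrt (real n)" for n
    using p(2)[of n] by simp
  ultimately show ?thesis unfolding T_def s_def by simp
qed

section \<open>The cross-section of the ellipse ensemble\<close>

lemma ellipse_weight:
  assumes "N > 0" "c > 0"
  shows "exp (- (real N * ellipse_potential c N z)) = aniso_weight (1 / real N) (c\<^sup>2 / (real N)\<^sup>2) z"
  using assms unfolding ellipse_potential_def aniso_weight_def gauss_weight_def exp_add[symmetric]
  by (simp add: field_simps power2_eq_square)

text \<open>
  The density \<open>1/pi\<close> in the reference measure turns the factor \<open>2 pi\<close> of the Gaussian norms into \<open>2\<close>.
\<close>
lemma ellipse_one_point_function:
  fixes c :: real
  assumes c: "c > 0" and N: "N > 0"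
  defines "v \<equiv> 1 / real N" and "w \<equiv> c\<^sup>2 / (real N)\<^sup>2"
  shows "one_point_function (ellipse_potential c N) N z =
    (\<Sum>m<N. (cmod (hermite (of_real (v - w)) m z))\<^sup>2 * aniso_weight v w z / (2 * sqrt (v * w) * (fact m * (v + w) ^ m)))"
proof -
  have v: "v > 0" and w: "w > 0" using c N by (simp_all add: v_def w_def)
  obtain P :: "nat \<Rightarrow> complex poly" where P: "\<And>k. degree (P k) = k" "\<And>k. coeff (P k) k = 1"
    "\<And>k z. poly (P k) z = hermite (of_real (v - w)) k z"
    using hermite_monic_poly[of _ "of_real (v - w) :: complex"] by metis
  define h where "h m = 2 * sqrt (v * w) * (fact m * (v + w) ^ m)" for m
  have cont: "continuous_on UNIV (ellipse_potential c N)"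
    unfolding ellipse_potential_def[abs_def] by (intro continuous_intros)
  have meas: "(\<lambda>z. hermite (of_real (v - w)) m z * cnj (hermite (of_real (v - w)) n z) * of_real (aniso_weight v w z)) \<in> borel_measurable borel" for m n
    unfolding aniso_weight_def by (intro borel_measurable_continuous_onI continuous_intros)
  interpret planar_orthogonal_polynomials P "ellipse_potential c N" N h
  proof
    fix m n k
    show "degree (P k) = k" "coeff (P k) k = 1" by (rule P)+
    show "ellipse_potential c N \<in> borel_measurable borel" using cont by (rule borel_measurable_continuous_onI)
    show "N > 0" by fact
    show "h k > 0" using v w by (simp add: h_def)
    show "integrable dA (\<lambda>z. poly (P m) z * cnj (poly (P n) z) * of_real (exp (- (real N * ellipse_potential c N z))))"
      unfolding ellipse_weight[OF N c] P v_def[symmetric] w_def[symmetric] integral_dA(2)[OF meas]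
      by (rule integrable_hermite_aniso[OF v w])
    show "(LINT z|dA. poly (P m) z * cnj (poly (P n) z) * of_real (exp (- (real N * ellipse_potential c N z)))) =
      (if m = n then of_real (h n) else 0)"
      unfolding ellipse_weight[OF N c] P v_def[symmetric] w_def[symmetric] integral_dA(1)[OF meas]
        hermite_aniso_orthogonal[OF v w]
      by (simp add: h_def scaleR_conv_of_real)
  qed
  show ?thesis
    unfolding one_point_function_eq_density[OF cont] particle_density_def weight_def ellipse_weight[OF N c] P h_def v_def w_def ..
qed

text \<open>
  One of the two binomial coefficients of the vertical integral cancels against the factorials of the norms; the powers of
  \<open>w\<close> and \<open>v + w\<close> combine with those inside \<open>hermite_density\<close> to binomial probabilities.
\<close>
lemma ellipse_cross_section:
  fixes c :: real
  assumes c: "c > 0" and N: "N > 0"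
  shows "cross_section (ellipse_potential c N) N \<xi> =
    sqrt (pi / 2) * ((\<Sum>m<N. binomial_mean (1 / (1 + c\<^sup>2 / real N)) m (\<lambda>k. hermite_density (1 / real N) k \<xi>)) / sqrt (real N))"
proof -
  define v where "v = 1 / real N"
  define w where "w = c\<^sup>2 / (real N)\<^sup>2"
  define p where "p = 1 / (1 + c\<^sup>2 / real N)"
  define h where "h m = 2 * sqrt (v * w) * (fact m * (v + w) ^ m)" for m
  have v: "v > 0" and w: "w > 0" using c N by (simp_all add: v_def w_def)
  have p: "p = v / (v + w)"
    unfolding p_def v_def w_def using N c by (simp add: field_simps power2_eq_square)
  have q: "1 - p = w / (v + w)"
    unfolding p using v w by (simp add: field_simps)
  define f where "f m \<eta> = (cmod (hermite (of_real (v - w)) m (Complex \<xi> \<eta>)))\<^sup>2 * gauss_weight w \<eta>" for m \<eta>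
  have s: "sqrt (2 * pi * w) / (2 * sqrt (v * w)) = sqrt (pi / 2) * sqrt (real N)"
  proof -
    have "sqrt (2 * pi * w) / (2 * sqrt (v * w)) = sqrt (2 * pi * w / (4 * (v * w)))"
    proof -
      have "2 * sqrt (v * w) = sqrt (4 * (v * w))" by (simp add: real_sqrt_mult)
      then show ?thesis by (simp only: real_sqrt_divide)
    qed
    also have "2 * pi * w / (4 * (v * w)) = pi / 2 * real N"
      using w N by (simp add: v_def)
    finally show ?thesis by (simp only: real_sqrt_mult)
  qed
  have summand: "(LINT \<eta>|lborel. f m \<eta>) * (gauss_weight v \<xi> / h m) =
     sqrt (pi / 2) * sqrt (real N) * binomial_mean p m (\<lambda>k. hermite_density v k \<xi>)" for m
  proof -
    have "(real (m choose k))\<^sup>2 * (fact (m - k) * w ^ (m - k)) * (hermite v k \<xi>)\<^sup>2 * gauss_weight v \<xi> / (fact m * (v + w) ^ m)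
       = real (m choose k) * (p ^ k * (1 - p) ^ (m - k)) * hermite_density v k \<xi>" if k: "k \<le> m" for k
    proof -
      have "fact k * fact (m - k) * real (m choose k) = fact m"
        using binomial_fact_lemma[OF k] by (metis of_nat_fact of_nat_mult)
      then have fm: "fact m = fact k * fact (m - k) * real (m choose k)" ..
      have e: "(v + w) ^ m = (v + w) ^ k * (v + w) ^ (m - k)" using k by (simp flip: power_add)
      have nz: "real (m choose k) \<noteq> 0" using k by simp
      show ?thesis unfolding hermite_density_def p q[unfolded p] power_divide fm e
        using v w nz by (simp add: power2_eq_square)
    qed
    then have "(\<Sum>k\<le>m. (real (m choose k))\<^sup>2 * (fact (m - k) * w ^ (m - k)) * (hermite v k \<xi>)\<^sup>2) * gauss_weight v \<xi> / (fact m * (v + w) ^ m)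
       = binomial_mean p m (\<lambda>k. hermite_density v k \<xi>)"
      unfolding binomial_mean_def sum_distrib_right sum_divide_distrib by (intro sum.cong) auto
    moreover have "(LINT \<eta>|lborel. f m \<eta>) * (gauss_weight v \<xi> / h m) = sqrt (2 * pi * w) / (2 * sqrt (v * w)) *
       ((\<Sum>k\<le>m. (real (m choose k))\<^sup>2 * (fact (m - k) * w ^ (m - k)) * (hermite v k \<xi>)\<^sup>2) * gauss_weight v \<xi> / (fact m * (v + w) ^ m))"
      unfolding f_def integral_hermite_vertical[OF w] h_def by simp
    ultimately show ?thesis by (simp only: s)
  qed
  have "(LINT \<eta>|lborel. one_point_function (ellipse_potential c N) N (Complex \<xi> \<eta>)) =
     (LINT \<eta>|lborel. (\<Sum>m<N. f m \<eta> * (gauss_weight v \<xi> / h m)))"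
    unfolding ellipse_one_point_function[OF c N] v_def[symmetric] w_def[symmetric] h_def[symmetric]
    by (intro Bochner_Integration.integral_cong sum.cong refl) (simp add: f_def aniso_weight_def)
  also have "\<dots> = (\<Sum>m<N. (LINT \<eta>|lborel. f m \<eta>) * (gauss_weight v \<xi> / h m))"
    using integrable_hermite_vertical[OF w] unfolding f_def
    by (subst Bochner_Integration.integral_sum) auto
  also have "\<dots> = sqrt (pi / 2) * sqrt (real N) * (\<Sum>m<N. binomial_mean p m (\<lambda>k. hermite_density v k \<xi>))"
    unfolding summand sum_distrib_left ..
  finally have "cross_section (ellipse_potential c N) N \<xi> =
     (1 / real N) * (sqrt (pi / 2) * sqrt (real N) * (\<Sum>m<N. binomial_mean p m (\<lambda>k. hermite_density v k \<xi>)))"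
    by (simp add: cross_section_def)
  also have "\<dots> = sqrt (pi / 2) * ((\<Sum>m<N. binomial_mean p m (\<lambda>k. hermite_density v k \<xi>)) * (sqrt (real N) / real N))"
    by simp
  also have "sqrt (real N) / real N = 1 / sqrt (real N)"
    by (simp add: real_div_sqrt sqrt_divide_self_eq inverse_eq_divide)
  finally show ?thesis by (simp add: p_def v_def)
qed

theorem theorem1p3:
  fixes c \<xi> :: real
  assumes "c > 0" and "-2 < \<xi>" and "\<xi> < 2"
  shows "(\<lambda>N. cross_section (ellipse_potential c N) N \<xi>) \<longlonglongrightarrow> pi * semicircle_density \<xi>"
proof -
  \<comment> \<open>This is \<open>n / (n + c\<^sup>2)\<close> for positive \<open>n\<close>, written so that it is also a positive number at \<open>n = 0\<close>, where
  \<open>c\<^sup>2 / 0 = 0\<close>.\<close>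
  define p where "p n = 1 / (1 + c\<^sup>2 / real n)" for n
  have p: "0 < p n" "p n \<le> 1" for n
    using assms(1) by (simp_all add: p_def add_pos_nonneg divide_le_eq)
  have "(\<lambda>n. 1 / (1 + c\<^sup>2 / real n)) \<longlonglongrightarrow> 1 / (1 + 0)"
    by (intro tendsto_intros lim_const_over_n) simp
  then have plim: "p \<longlonglongrightarrow> 1" by (simp add: p_def[abs_def])
  have "(\<lambda>N. sqrt (pi / 2) * ((\<Sum>k<N. binomial_mean (p N) k (\<lambda>j. hermite_density (1 / real N) j \<xi>)) / sqrt (real N)))
     \<longlonglongrightarrow> sqrt (pi / 2) * (sqrt (2 / pi) * sqrt (1 - \<xi>\<^sup>2 / 4))"
    by (intro tendsto_mult tendsto_const thinned_hermite_kernel_semicircle assms plim p)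
  also have "sqrt (pi / 2) * (sqrt (2 / pi) * sqrt (1 - \<xi>\<^sup>2 / 4)) = sqrt (1 - \<xi>\<^sup>2 / 4)"
    unfolding mult.assoc[symmetric] by (subst real_sqrt_mult[symmetric]) simp
  also have "\<dots> = pi * semicircle_density \<xi>"
  proof -
    have "sqrt (1 - \<xi>\<^sup>2 / 4) = sqrt ((4 - \<xi>\<^sup>2) / 4)" by (simp add: field_simps)
    also have "\<dots> = sqrt (4 - \<xi>\<^sup>2) / 2" by (simp add: real_sqrt_divide)
    finally show ?thesis using assms by (simp add: semicircle_density_def)
  qed
  finally show ?thesis
  proof (rule Lim_transform_eventually, intro eventually_sequentiallyI[of 1])
    fix N :: nat assume "1 \<le> N"
    then show "sqrt (pi / 2) * ((\<Sum>k<N. binomial_mean (p N) k (\<lambda>j. hermite_density (1 / real N) j \<xi>)) / sqrt (real N)) =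
        cross_section (ellipse_potential c N) N \<xi>"
      unfolding p_def by (subst ellipse_cross_section[OF assms(1)]) auto
  qed
qed

end
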